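(* Let $p$ and $q$ be positive integers $\ge 3$ with $p$ even and $q$ not divisible by $4$. Each element of $G(p,q)$ can be uniquely written in L-canonical form, and uniquely written in R-canonical form, and uniquely written in C-canonical form.
   Context: $R_x^{\theta}, R_z^{\theta}\in SO(3)$ denote the rotations of Euclidean 3-space by angle $\theta$ (right-hand rule) about the $x$- and $z$-axis. $G(p,q)\subset SO(3)$ is the group generated by $A=R_x^{2\pi/p}$ and $B=R_z^{2\pi/q}$. Let $p,q\ge 3$ with $p$ even and $q$ not divisible by $4$. Consider products $$A^{a_1}B^{b_1}\cdots A^{a_n}B^{b_n}\qquad(n\ge1)$$ with integer exponents, all nonzero except perhaps $a_1$ and $b_n$ (which are allowed to be zero). Such a product is in L-canonical form if: for $i>1$, $a_i\in(-\frac p4,\frac p4]$; $a_1\in(-\frac p2,\frac p2]$; $b_1\in(-\frac q2,\frac q2]$, and $b_1$ may equal $q/2$ only if $n=1$; for $j>1$, $b_j\in(-\frac q2,\frac q2)$ if $q$ is odd and $b_j\in(-\frac q4,\frac q4)$ if $q$ is even. Such a product is in R-canonical form if: for $i<n$, $a_i\in(-\frac p4,\frac p4]$; $a_n\in(-\frac p2,\frac p2]$, and $a_n$ may equal $p/2$ only if $n=1$; $b_n\in(-\frac q2,\frac q2]$; for $j<n$, $b_j\in(-\frac q2,\frac q2)$ if $q$ is odd and $b_j\in(-\frac q4,\frac q4)$ if $q$ is even. Such a product is in C-canonical form if: for $i>1$, $a_i\in(-\frac p4,\frac p4]$; $a_1\in(-\frac p2,\frac p2]$; $b_n\in(-\frac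 q2,\frac q2]$; for $j<n$, $b_j\in(-\frac q2,\frac q2)$ if $q$ is odd and $b_j\in(-\frac q4,\frac q4)$ if $q$ is even. "Uniquely written" means that $n$ and all the exponents $a_i,b_j$ are uniquely determined by the group element. *)

theory Defs
  imports "HOL-Analysis.Analysis" "HOL-Algebra.Generated_Groups"
begin

text \<open>Rotations are \<open>3 \<times> 3\<close> real matrices acting on column vectors, so that the matrix product
  is composition of rotations.\<close>

definition SO3 :: "(real^3^3) monoid" where
  "SO3 = \<lparr>carrier = {Q. orthogonal_matrix Q \<and> det Q = 1}, mult = (**), one = mat 1\<rparr>"

definition Rx :: "real \<Rightarrow> real^3^3" where
  "Rx \<theta> = vector [vector [1, 0, 0],
                   vector [0, cos \<theta>, - sin \<theta>],
                   vector [0, sin \<theta>, cos \<theta>]]"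

definition Rz :: "real \<Rightarrow> real^3^3" where
  "Rz \<theta> = vector [vector [cos \<theta>, - sin \<theta>, 0],
                   vector [sin \<theta>, cos \<theta>, 0],
                   vector [0, 0, 1]]"

definition A_gen :: "nat \<Rightarrow> real^3^3" where
  "A_gen p = Rx (2 * pi / real p)"

definition B_gen :: "nat \<Rightarrow> real^3^3" where
  "B_gen q = Rz (2 * pi / real q)"

definition G :: "nat \<Rightarrow> nat \<Rightarrow> (real^3^3) set" where
  "G p q = generate SO3 {A_gen p, B_gen q}"

lemma group_SO3: "group SO3"
proof (rule groupI)
  show "\<exists>y\<in>carrier SO3. y \<otimes>\<^bsub>SO3\<^esub> x = \<one>\<^bsub>SO3\<^esub>" if "x \<in> carrier SO3" for x
    using that
    by (intro bexI[of _ "transpose x"])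
       (auto simp: SO3_def det_transpose orthogonal_matrix_def dest: matrix_left_right_inverse[THEN iffD1])
qed (auto simp: SO3_def orthogonal_matrix_mul orthogonal_matrix_id det_mul matrix_mul_assoc)

lemma Rx_in_SO3: "Rx \<theta> \<in> carrier SO3"
proof -
  have "cos \<theta> * cos \<theta> + sin \<theta> * sin \<theta> = 1"
    using sin_cos_squared_add[of \<theta>] by (simp add: power2_eq_square)
  then show ?thesis
    by (simp add: SO3_def Rx_def orthogonal_matrix det_3 vec_eq_iff forall_3 matrix_matrix_mult_def
        transpose_def mat_def sum_3 add.commute)
qed

lemma Rz_in_SO3: "Rz \<theta> \<in> carrier SO3"
proof -
  have "cos \<theta> * cos \<theta> + sin \<theta> * sin \<theta> = 1"
    using sin_cos_squared_add[of \<theta>] by (simp add: power2_eq_square)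
  then show ?thesis
    by (simp add: SO3_def Rz_def orthogonal_matrix det_3 vec_eq_iff forall_3 matrix_matrix_mult_def
        transpose_def mat_def sum_3 add.commute)
qed

text \<open>A list \<open>[(a\<^sub>1, b\<^sub>1), \<dots>, (a\<^sub>n, b\<^sub>n)]\<close> of exponent pairs stands for the formal product
  \<open>A\<^bsup>a\<^sub>1\<^esup> B\<^bsup>b\<^sub>1\<^esup> \<dots> A\<^bsup>a\<^sub>n\<^esup> B\<^bsup>b\<^sub>n\<^esup>\<close>. List positions start at 0, so \<open>a\<^sub>i\<close> is
  \<open>fst (ws ! (i - 1))\<close>, and likewise for \<open>b\<^sub>j\<close>.\<close>

fun product_value :: "nat \<Rightarrow> nat \<Rightarrow> (int \<times> int) list \<Rightarrow> real^3^3" where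
  "product_value p q [] = \<one>\<^bsub>SO3\<^esub>"
| "product_value p q ((a, b) # ws) =
     (A_gen p [^]\<^bsub>SO3\<^esub> a) \<otimes>\<^bsub>SO3\<^esub> (B_gen q [^]\<^bsub>SO3\<^esub> b) \<otimes>\<^bsub>SO3\<^esub> product_value p q ws"

definition is_product :: "(int \<times> int) list \<Rightarrow> bool" where
  "is_product ws \<longleftrightarrow> ws \<noteq> [] \<and>
     (\<forall>i<length ws. 0 < i \<longrightarrow> fst (ws ! i) \<noteq> 0) \<and>
     (\<forall>j<length ws - 1. snd (ws ! j) \<noteq> 0)"

definition full_range :: "nat \<Rightarrow> int set" where
  "full_range m = {k. - (real m / 2) < real_of_int k \<and> real_of_int k \<le> real m / 2}"

definition A_range :: "nat \<Rightarrow> int set" where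
  "A_range p = {a. - (real p / 4) < real_of_int a \<and> real_of_int a \<le> real p / 4}"

definition B_range :: "nat \<Rightarrow> int set" where
  "B_range q =
     (if odd q then {b. - (real q / 2) < real_of_int b \<and> real_of_int b < real q / 2}
      else {b. - (real q / 4) < real_of_int b \<and> real_of_int b < real q / 4})"

definition L_canonical :: "nat \<Rightarrow> nat \<Rightarrow> (int \<times> int) list \<Rightarrow> bool" where
  "L_canonical p q ws \<longleftrightarrow> is_product ws \<and>
     (\<forall>i<length ws. 0 < i \<longrightarrow> fst (ws ! i) \<in> A_range p) \<and>
     fst (ws ! 0) \<in> full_range p \<and>
     snd (ws ! 0) \<in> full_range q \<and>
     (real_of_int (snd (ws ! 0)) = real q / 2 \<longrightarrow> length ws = 1) \<and>
     (\<forall>j<length ws. 0 < j \<longrightarrow> snd (ws ! j) \<in> B_range q)"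

definition R_canonical :: "nat \<Rightarrow> nat \<Rightarrow> (int \<times> int) list \<Rightarrow> bool" where
  "R_canonical p q ws \<longleftrightarrow> is_product ws \<and>
     (\<forall>i<length ws - 1. fst (ws ! i) \<in> A_range p) \<and>
     fst (ws ! (length ws - 1)) \<in> full_range p \<and>
     (real_of_int (fst (ws ! (length ws - 1))) = real p / 2 \<longrightarrow> length ws = 1) \<and>
     snd (ws ! (length ws - 1)) \<in> full_range q \<and>
     (\<forall>j<length ws - 1. snd (ws ! j) \<in> B_range q)"

definition C_canonical :: "nat \<Rightarrow> nat \<Rightarrow> (int \<times> int) list \<Rightarrow> bool" where
  "C_canonical p q ws \<longleftrightarrow> is_product ws \<and>
     (\<forall>i<length ws. 0 < i \<longrightarrow> fst (ws ! i) \<in> A_range p) \<and>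
     fst (ws ! 0) \<in> full_range p \<and>
     snd (ws ! (length ws - 1)) \<in> full_range q \<and>
     (\<forall>j<length ws - 1. snd (ws ! j) \<in> B_range q)"

end

theory Submission
  imports Defs
begin

text \<open>The half turns among the powers of \<open>A\<close> and \<open>B\<close> generate a group \<open>D\<close> of order 2 or 4 that
  normalises the groups generated by \<open>A\<close> and by \<open>B\<close>. Pushing elements of \<open>D\<close> to the left or to the
  right brings a word of minimal length into any of the three canonical forms, without changing its
  length.

  Uniqueness rests on a 2-adic argument. Unless \<open>\<theta>\<close> is a multiple of a quarter turn, \<open>cos \<theta>\<close> has a
  2-adic pole and \<open>tan \<theta>\<close> is congruent to 1 modulo the primes above 2, so \<open>Rx \<theta> / cos \<theta>\<close> and
  \<open>Rz \<theta> / cos \<theta>\<close> reduce to the rank-one projections along \<open>(0, 1, 1)\<close> and \<open>(1, 1, 0)\<close>.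
  Since these vectors are not orthogonal in characteristic 2, products of such rotations with at
  least one nontrivial power of \<open>B\<close> do not have 2-adically integral entries, and hence lie outside
  the dihedral group generated by \<open>A\<close> and the half turn about the z-axis. The hypothesis that 4
  does not divide \<open>q\<close> excludes quarter turns about the z-axis; those about the x-axis only permute
  coordinates up to sign and are harmless.\<close>

section \<open>A prime above 2 in the cyclotomic integers\<close>

text \<open>The localisation of the integers at 2, embedded in the complex numbers.\<close>

definition odd_denom :: "complex set" where
  "odd_denom = {of_int a / of_int b |a b. odd b}"

lemma odd_denom_of_int: "of_int a \<in> odd_denom"
  unfolding odd_denom_def by (rule CollectI, rule exI[of _ a], rule exI[of _ 1]) simp

lemma odd_denom_inverse_odd: "odd b \<Longrightarrow> 1 / of_int b \<in> odd_denom"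
  unfolding odd_denom_def by (rule CollectI, rule exI[of _ 1], rule exI[of _ b]) simp

lemma odd_denom_mult: "x \<in> odd_denom \<Longrightarrow> y \<in> odd_denom \<Longrightarrow> x * y \<in> odd_denom"
proof -
  assume "x \<in> odd_denom" "y \<in> odd_denom"
  then obtain a b c d where "x = of_int a / of_int b" "odd b" "y = of_int c / of_int d" "odd d"
    unfolding odd_denom_def by blast
  then show ?thesis
    unfolding odd_denom_def
    by (intro CollectI exI[of _ "a * c"] exI[of _ "b * d"]) auto
qed

lemma odd_denom_add: "x \<in> odd_denom \<Longrightarrow> y \<in> odd_denom \<Longrightarrow> x + y \<in> odd_denom"
proof -
  assume "x \<in> odd_denom" "y \<in> odd_denom"
  then obtain a b c d where x: "x = of_int a / of_int b" "odd b" and y: "y = of_int c / of_int d" "odd d"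
    unfolding odd_denom_def by blast
  then have "b \<noteq> 0" "d \<noteq> 0" by auto
  then have "x + y = of_int (a * d + c * b) / of_int (b * d)"
    by (simp add: x y add_frac_eq)
  then show ?thesis
    unfolding odd_denom_def using x y
    by (intro CollectI exI[of _ "a * d + c * b"] exI[of _ "b * d"]) auto
qed

text \<open>For \<open>c = a / b\<close> the numerator of \<open>1 - 2 * c\<close> is
  \<open>b - 2 * a\<close>, which is odd: 2 lies in the maximal ideal.\<close>

lemma odd_denom_inverse_one_minus_double:
  assumes "c \<in> odd_denom"
  shows "1 - 2 * c \<noteq> 0" "1 / (1 - 2 * c) \<in> odd_denom"
proof -
  obtain a b where c: "c = of_int a / of_int b" and b: "odd b"
    using assms unfolding odd_denom_def by blast
  have b0: "b \<noteq> 0" and d: "odd (b - 2 * a)" using b by auto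
  have eq: "1 - 2 * c = of_int (b - 2 * a) / of_int b"
    using b0 by (simp add: c field_simps)
  have "b - 2 * a \<noteq> 0" using d by presburger
  then have "(of_int (b - 2 * a) :: complex) \<noteq> 0" by (simp only: of_int_eq_0_iff not_False_eq_True)
  then show "1 - 2 * c \<noteq> 0" using b0 by (simp add: eq)
  show "1 / (1 - 2 * c) \<in> odd_denom"
    unfolding odd_denom_def using d b0
    by (intro CollectI exI[of _ b] exI[of _ "b - 2 * a"]) (simp add: eq)
qed

inductive_set odd_denom_span :: "complex set \<Rightarrow> complex set" for S where
  zero: "0 \<in> odd_denom_span S"
| step: "c \<in> odd_denom \<Longrightarrow> s \<in> S \<Longrightarrow> w \<in> odd_denom_span S \<Longrightarrow> c * s + w \<in> odd_denom_span S"

lemma odd_denom_span_add: "x \<in> odd_denom_span S \<Longrightarrow> y \<in> odd_denom_span S \<Longrightarrow> x + y \<in> odd_denom_span S"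
  by (induction rule: odd_denom_span.induct) (auto simp: add.assoc intro: odd_denom_span.intros)

lemma odd_denom_span_scale: "x \<in> odd_denom_span S \<Longrightarrow> c \<in> odd_denom \<Longrightarrow> c * x \<in> odd_denom_span S"
  by (induction rule: odd_denom_span.induct)
     (auto simp: distrib_left mult.assoc[symmetric] intro: odd_denom_span.intros odd_denom_mult)

text \<open>Collecting the coefficients of \<open>v\<close> lets Nakayama's lemma eliminate one
  generator at a time.\<close>

lemma odd_denom_span_insert:
  assumes "x \<in> odd_denom_span (insert v S)"
  shows "\<exists>c\<in>odd_denom. \<exists>w\<in>odd_denom_span S. x = c * v + w"
  using assms
proof induction
  case zero
  show ?case using odd_denom_of_int[of 0] odd_denom_span.zero[of S] by force
next
  case (step c s w)
  then obtain d u where d: "d \<in> odd_denom" "u \<in> odd_denom_span S" "w = d * v + u" by blast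
  show ?case
  proof (cases "s = v")
    case True
    have "c + d \<in> odd_denom" using step(1) d(1) by (rule odd_denom_add)
    moreover have "c * s + w = (c + d) * v + u" using d True by (simp add: algebra_simps)
    ultimately show ?thesis using d(2) by blast
  next
    case False
    then have "c * s + u \<in> odd_denom_span S" using step d by (auto intro: odd_denom_span.intros)
    moreover have "c * s + w = d * v + (c * s + u)" using d by simp
    ultimately show ?thesis using d(1) by blast
  qed
qed

text \<open>Nakayama's lemma for the local ring of rationals with odd denominator.\<close>

lemma odd_denom_span_divisible_trivial:
  assumes "finite S" "\<And>x. x \<in> odd_denom_span S \<Longrightarrow> x / 2 \<in> odd_denom_span S"
  shows "odd_denom_span S \<subseteq> {0}"
  using assms
proof (induction S)
  case empty
  have "x = 0" if "x \<in> odd_denom_span {}" for x using that by induction auto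
  then show ?case by blast
next
  case (insert v S)
  have "1 * v + 0 \<in> odd_denom_span (insert v S)"
    using odd_denom_of_int[of 1] by (intro odd_denom_span.intros) auto
  then have "v / 2 \<in> odd_denom_span (insert v S)" using insert.prems by simp
  then obtain c w where c: "c \<in> odd_denom" and w: "w \<in> odd_denom_span S" and eq: "v / 2 = c * v + w"
    using odd_denom_span_insert by blast
  have "(1 - 2 * c) * v = 2 * w" using eq by (simp add: field_simps)
  then have "v = (1 / (1 - 2 * c) * of_int 2) * w"
    using odd_denom_inverse_one_minus_double(1)[OF c] by (simp add: field_simps)
  then have v: "v \<in> odd_denom_span S"
    using odd_denom_span_scale[OF w odd_denom_mult[OF odd_denom_inverse_one_minus_double(2)[OF c] odd_denom_of_int[of 2]]] by simp
  have sub: "odd_denom_span (insert v S) \<subseteq> odd_denom_span S"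
  proof
    fix x assume "x \<in> odd_denom_span (insert v S)"
    then obtain d u where "d \<in> odd_denom" "u \<in> odd_denom_span S" "x = d * v + u" using odd_denom_span_insert by blast
    then show "x \<in> odd_denom_span S" using v by (auto intro: odd_denom_span_add odd_denom_span_scale)
  qed
  have sup: "x \<in> odd_denom_span (insert v S)" if "x \<in> odd_denom_span S" for x
    using that by induction (auto intro: odd_denom_span.intros)
  have "odd_denom_span S \<subseteq> {0}"
    using insert.IH insert.prems sub sup by blast
  then show ?case using sub by blast
qed

text \<open>The ring of \<open>N\<close>-th cyclotomic integers localised at 2. Roots of unity are
  closed under products, so their span is a ring; for \<open>N > 0\<close> it is finitely generated
  as a module.\<close>

definition cycl :: "nat \<Rightarrow> complex set" where
  "cycl N = odd_denom_span {z. z ^ N = 1}"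

lemma cycl_odd_denom_root: "c \<in> odd_denom \<Longrightarrow> z ^ N = 1 \<Longrightarrow> c * z \<in> cycl N"
  unfolding cycl_def using odd_denom_span.intros(2)[of c z "{z. z ^ N = 1}" 0] odd_denom_span.zero by simp

lemma cycl_root: "z ^ N = 1 \<Longrightarrow> z \<in> cycl N"
  using cycl_odd_denom_root[OF odd_denom_of_int[of 1]] by simp

lemma cycl_odd_denom: "c \<in> odd_denom \<Longrightarrow> c \<in> cycl N"
  using cycl_odd_denom_root[of c 1 N] by simp

lemma cycl_of_int: "of_int k \<in> cycl N"
  using cycl_odd_denom odd_denom_of_int by blast

lemma cycl_of_nat: "of_nat k \<in> cycl N"
  using cycl_of_int[of "int k"] by simp

lemma cycl_0: "0 \<in> cycl N" and cycl_1: "1 \<in> cycl N" and cycl_2: "2 \<in> cycl N"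
  using cycl_of_int[of 0 N] cycl_of_int[of 1 N] cycl_of_int[of 2 N] by simp_all

lemma cycl_add: "x \<in> cycl N \<Longrightarrow> y \<in> cycl N \<Longrightarrow> x + y \<in> cycl N"
  unfolding cycl_def by (rule odd_denom_span_add)

lemma cycl_root_mult:
  assumes "z ^ N = 1" "y \<in> cycl N"
  shows "z * y \<in> cycl N"
  using assms(2) unfolding cycl_def
proof induction
  case zero
  then show ?case by (simp add: odd_denom_span.zero)
next
  case (step c s w)
  have "c * (z * s) + z * w \<in> odd_denom_span {z. z ^ N = 1}"
    using step assms(1) by (intro odd_denom_span.intros) (auto simp: power_mult_distrib)
  then show ?case by (simp add: algebra_simps)
qed

lemma cycl_mult:
  assumes "x \<in> cycl N" "y \<in> cycl N"
  shows "x * y \<in> cycl N"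
  using assms(1) unfolding cycl_def
proof induction
  case zero
  then show ?case by (simp add: odd_denom_span.zero)
next
  case (step c s w)
  have "c * (s * y) \<in> cycl N"
    using step cycl_root_mult[OF _ assms(2), of s] odd_denom_span_scale unfolding cycl_def by blast
  then have "c * (s * y) + w * y \<in> cycl N"
    using step by (intro cycl_add) (auto simp: cycl_def)
  then show ?case by (simp add: algebra_simps cycl_def)
qed

lemma cycl_minus: "x \<in> cycl N \<Longrightarrow> - x \<in> cycl N"
  using cycl_mult[OF cycl_of_int[of "-1"]] by simp

lemma cycl_diff: "x \<in> cycl N \<Longrightarrow> y \<in> cycl N \<Longrightarrow> x - y \<in> cycl N"
  using cycl_add[OF _ cycl_minus] by fastforce

lemma cycl_power: "x \<in> cycl N \<Longrightarrow> x ^ k \<in> cycl N"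
  by (induction k) (auto intro: cycl_mult cycl_1)

lemma cycl_sum: "(\<And>i. i \<in> I \<Longrightarrow> f i \<in> cycl N) \<Longrightarrow> sum f I \<in> cycl N"
  by (induction I rule: infinite_finite_induct) (auto intro: cycl_add cycl_0)

text \<open>If 1/2 were present, the module would be 2-divisible and hence zero by Nakayama's lemma,
  although it contains 1.\<close>

lemma half_notin_cycl:
  assumes "N > 0"
  shows "1 / 2 \<notin> cycl N"
proof
  assume half: "1 / 2 \<in> cycl N"
  have "x / 2 \<in> cycl N" if "x \<in> cycl N" for x
    using cycl_mult[OF that half] by simp
  then have "cycl N \<subseteq> {0}"
    unfolding cycl_def using assms
    by (intro odd_denom_span_divisible_trivial finite_roots_unity) auto
  then show False using cycl_1[of N] by auto
qed

text \<open>The radical of the ideal generated by 2, that is, the intersection of the primes above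
  2. It avoids the choice of one prime.\<close>

definition cycl_rad :: "nat \<Rightarrow> complex set" where
  "cycl_rad N = {x \<in> cycl N. \<exists>k. x ^ k / 2 \<in> cycl N}"

lemma cycl_rad_subset: "x \<in> cycl_rad N \<Longrightarrow> x \<in> cycl N"
  by (simp add: cycl_rad_def)

lemma one_notin_cycl_rad: "N > 0 \<Longrightarrow> 1 \<notin> cycl_rad N"
  using half_notin_cycl by (auto simp: cycl_rad_def)

lemma cycl_rad_double: "x \<in> cycl N \<Longrightarrow> 2 * x \<in> cycl_rad N"
  unfolding cycl_rad_def by (auto intro!: exI[of _ 1] cycl_mult cycl_2)

lemma cycl_rad_mult:
  assumes "x \<in> cycl_rad N" "y \<in> cycl N"
  shows "x * y \<in> cycl_rad N"
proof -
  obtain k where k: "x ^ k / 2 \<in> cycl N" and x: "x \<in> cycl N"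
    using assms unfolding cycl_rad_def by blast
  have "x ^ k / 2 * y ^ k \<in> cycl N" using k assms by (intro cycl_mult cycl_power)
  then show ?thesis using x assms unfolding cycl_rad_def
    by (auto intro!: cycl_mult exI[of _ k] simp: power_mult_distrib)
qed

lemma cycl_rad_power: "x \<in> cycl N \<Longrightarrow> x ^ n \<in> cycl_rad N \<Longrightarrow> x \<in> cycl_rad N"
  unfolding cycl_rad_def by (auto simp flip: power_mult)

text \<open>Every binomial term of \<open>(x + y) ^ (k + l)\<close> contains at least
  \<open>k\<close> factors \<open>x\<close> or at least \<open>l\<close> factors
  \<open>y\<close>.\<close>

lemma cycl_rad_add:
  assumes "x \<in> cycl_rad N" "y \<in> cycl_rad N"
  shows "x + y \<in> cycl_rad N"
proof -
  obtain k l where k: "x ^ k / 2 \<in> cycl N" and x: "x \<in> cycl N"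
    and l: "y ^ l / 2 \<in> cycl N" and y: "y \<in> cycl N"
    using assms unfolding cycl_rad_def by blast
  have "of_nat ((k + l) choose i) * x ^ i * y ^ (k + l - i) / 2 \<in> cycl N" if i: "i \<le> k + l" for i
  proof (cases "i \<ge> k")
    case True
    have "of_nat ((k + l) choose i) * (x ^ k / 2) * (x ^ (i - k)) * y ^ (k + l - i) \<in> cycl N"
      by (intro cycl_mult cycl_of_nat cycl_power k x y)
    moreover have "x ^ i = x ^ k * x ^ (i - k)" using True by (simp flip: power_add)
    ultimately show ?thesis by (simp add: mult_ac)
  next
    case False
    have "of_nat ((k + l) choose i) * x ^ i * ((y ^ l / 2) * y ^ (k - i)) \<in> cycl N"
      by (intro cycl_mult cycl_of_nat cycl_power l x y)
    moreover have "y ^ (k + l - i) = y ^ l * y ^ (k - i)" using False by (simp add: add.commute flip: power_add)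
    ultimately show ?thesis by (simp add: mult_ac)
  qed
  then have "(\<Sum>i\<le>k + l. of_nat ((k + l) choose i) * x ^ i * y ^ (k + l - i) / 2) \<in> cycl N"
    by (intro cycl_sum) auto
  then have "(x + y) ^ (k + l) / 2 \<in> cycl N"
    by (simp add: binomial_ring sum_divide_distrib)
  then show ?thesis using x y unfolding cycl_rad_def by (auto intro: cycl_add)
qed

text \<open>Squaring is additive modulo 2; this iterates that Frobenius map.\<close>

lemma one_plus_root_power_two:
  assumes "w ^ N = 1"
  shows "\<exists>y\<in>cycl N. (1 + w) ^ (2 ^ i) = 1 + w ^ (2 ^ i) + 2 * y"
proof (induction i)
  case 0
  then show ?case using cycl_0 by auto
next
  case (Suc i)
  then obtain y where y: "y \<in> cycl N" and eq: "(1 + w) ^ (2 ^ i) = 1 + w ^ (2 ^ i) + 2 * y" by blast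
  define v where "v = w ^ (2 ^ i)"
  have v: "v \<in> cycl N" unfolding v_def using assms by (intro cycl_power cycl_root)
  have "(1 + w) ^ (2 ^ Suc i) = (1 + v + 2 * y)\<^sup>2"
    using eq by (simp add: v_def power_mult mult.commute[of 2])
  also have "\<dots> = 1 + v\<^sup>2 + 2 * (v + 2 * y * (1 + v) + 2 * y * y)"
    by (simp add: power2_eq_square algebra_simps)
  also have "v\<^sup>2 = w ^ (2 ^ Suc i)" by (simp add: v_def power_mult mult.commute[of 2])
  finally show ?case
    using y v by (blast intro: cycl_add cycl_mult cycl_1 cycl_2)
qed

text \<open>If the order of \<open>w\<close> has an odd prime factor, \<open>1 - w\<close> is a
  unit. Otherwise the order is a power of 2 and at least 4; then \<open>2 / (1 - w)\<close> is
  \<open>1 + w\<close>, which lies in the radical, times the ring element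
  \<open>2 / (1 - w^2)\<close>.\<close>

lemma double_inverse_one_minus_root:
  assumes w: "w ^ N = 1" "w \<noteq> 1" "w \<noteq> -1" and N: "N > 0"
  shows "2 / (1 - w) \<in> cycl_rad N"
proof -
  obtain k r where N_eq: "N = 2 ^ k * r" and r: "odd r"
    using N by (metis gr_implies_not0 multiplicity_decompose' not_is_unit_0 odd_one dvd_refl)
  show ?thesis
  proof (cases "w ^ (2 ^ k) = 1")
    case False
    define v where "v = w ^ (2 ^ k)"
    have v: "v ^ r = 1" "v \<noteq> 1" using False w by (auto simp: v_def N_eq power_mult)
    have vc: "v \<in> cycl N" unfolding v_def by (intro cycl_power cycl_root w)
    \<comment> \<open>At \<open>n = r\<close> the sum on the right vanishes, being \<open>v\<close>
      times a full geometric sum. This inverts \<open>1 - v\<close> with the odd denominator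
      \<open>r\<close>.\<close>
    have sum: "(\<Sum>j<n. of_nat j * v ^ j) * (v - 1) = of_nat n * v ^ n - (\<Sum>j<n. v ^ Suc j)" for n
      by (induction n) (auto simp: algebra_simps)
    have "(\<Sum>j<r. v ^ Suc j) = v * ((\<Sum>j<r. v ^ j))" by (simp add: sum_distrib_left)
    also have "\<dots> = 0" using v by (simp add: geometric_sum)
    finally have "(\<Sum>j<r. of_nat j * v ^ j) * (v - 1) = of_nat r" using sum[of r] v by simp
    moreover have "r \<noteq> 0" using r by (cases r) auto
    ultimately have inv_v: "1 / (1 - v) = - (1 / of_int (int r)) * (\<Sum>j<r. of_nat j * v ^ j)"
      using v by (simp add: field_simps)
    have "1 / (1 - v) \<in> cycl N"
      unfolding inv_v using r vc
      by (intro cycl_mult cycl_minus cycl_sum cycl_power cycl_of_nat cycl_odd_denom[OF odd_denom_inverse_odd]) auto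
    moreover have "1 / (1 - w) = (\<Sum>j<2 ^ k. w ^ j) * (1 / (1 - v))"
    proof -
      have "(\<Sum>j<2 ^ k. w ^ j) = (1 - v) / (1 - w)"
        using w by (metis geometric_sum minus_diff_eq minus_divide_divide v_def)
      then show ?thesis using v by simp
    qed
    moreover have "(\<Sum>j<2 ^ k. w ^ j) \<in> cycl N"
      using w by (intro cycl_sum cycl_power cycl_root)
    ultimately have "1 / (1 - w) \<in> cycl N" by (simp only: cycl_mult)
    then show ?thesis using cycl_rad_double by fastforce
  next
    case True
    \<comment> \<open>The order of \<open>w\<close> is exactly \<open>2 ^ j\<close>, and
      \<open>j\<close> is at least 2, so \<open>w ^ (2 ^ (j - 1)) = -1\<close>.\<close>
    define j where "j = (LEAST j. w ^ (2 ^ j) = 1)"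
    have j: "w ^ (2 ^ j) = 1" unfolding j_def using True by (rule LeastI)
    have "j \<noteq> 0" using j w by (cases j) auto
    moreover have "j \<noteq> 1" using j w by (auto simp: power2_eq_1_iff)
    ultimately obtain i where i: "j = Suc (Suc i)" by (metis One_nat_def not0_implies_Suc)
    have "w ^ (2 ^ Suc i) \<noteq> 1" using not_less_Least[of "Suc i" "\<lambda>j. w ^ (2 ^ j) = 1"] i j_def by auto
    moreover have "(w ^ (2 ^ Suc i))\<^sup>2 = 1" using j i by (simp flip: power_mult add: mult.commute)
    ultimately have m1: "w ^ (2 ^ Suc i) = -1" by (simp add: power2_eq_1_iff)
    obtain y where y: "y \<in> cycl N" "(1 + w) ^ (2 ^ Suc i) = 1 + w ^ (2 ^ Suc i) + 2 * y"
      using one_plus_root_power_two[OF w(1)] by blast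
    then have "(1 + w) ^ (2 ^ Suc i) \<in> cycl_rad N" using m1 cycl_rad_double by simp
    then have rad: "1 + w \<in> cycl_rad N"
      by (rule cycl_rad_power[rotated]) (intro cycl_add cycl_1 cycl_root w)
    have w2: "w\<^sup>2 \<noteq> 1" using w by (simp add: power2_eq_1_iff)
    have "(w\<^sup>2) ^ (2 ^ i) = -1" using m1 by (simp flip: power_mult)
    then have "(\<Sum>l<2 ^ i. (w\<^sup>2) ^ l) = (-1 - 1) / (w\<^sup>2 - 1)"
      using geometric_sum[OF w2, of "2 ^ i"] by (simp only:)
    also have "\<dots> = 2 / (1 - w\<^sup>2)" using w2 by (simp add: field_simps)
    finally have "(\<Sum>l<2 ^ i. (w\<^sup>2) ^ l) = 2 / (1 - w\<^sup>2)" .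
    moreover have "1 - w\<^sup>2 = (1 + w) * (1 - w)" by (simp add: power2_eq_square algebra_simps)
    moreover have "1 + w \<noteq> 0" using w by (metis add_eq_0_iff)
    ultimately have "2 / (1 - w) = (1 + w) * (\<Sum>l<2 ^ i. (w\<^sup>2) ^ l)"
      by (simp only: times_divide_eq_right mult_divide_mult_cancel_left not_False_eq_True)
    moreover have "(\<Sum>l<2 ^ i. (w\<^sup>2) ^ l) \<in> cycl N"
      using w by (intro cycl_sum cycl_power cycl_root)
    ultimately show ?thesis using rad by (simp only: cycl_rad_mult)
  qed
qed

text \<open>The interface between the arithmetic and the ping-pong argument: a proper ideal
  \<open>M\<close> containing 2. Multiplication enters only through \<open>M_mult\<close>.\<close>

locale dyadic_ideal =
  fixes R M :: "real set"
  assumes R_add: "x \<in> R \<Longrightarrow> y \<in> R \<Longrightarrow> x + y \<in> R"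
    and R_minus: "x \<in> R \<Longrightarrow> - x \<in> R"
    and R_1: "1 \<in> R"
    and M_R: "x \<in> M \<Longrightarrow> x \<in> R"
    and M_add: "x \<in> M \<Longrightarrow> y \<in> M \<Longrightarrow> x + y \<in> M"
    and M_mult: "x \<in> M \<Longrightarrow> y \<in> R \<Longrightarrow> x * y \<in> M"
    and M_2: "2 \<in> M"
    and M_1: "1 \<notin> M"

text \<open>The real elements of the cyclotomic ring and of its radical serve. With
  \<open>z = cis t\<close> and \<open>u = 2 / (1 + z^2)\<close> in the radical,
  \<open>1 / cos t = u * z\<close> and \<open>tan t = - i + i * u\<close>; \<open>4 dvd N\<close>
  puts \<open>i\<close> into the ring.\<close>

lemma exists_dyadic_ideal:
  assumes "N > 0" "4 dvd N"
  shows "\<exists>R M. dyadic_ideal R M \<and>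
    (\<forall>t. cis t ^ N = 1 \<longrightarrow> cis t ^ 4 \<noteq> 1 \<longrightarrow> 1 / cos t \<in> M \<and> tan t \<in> R \<and> tan t - 1 \<in> M)"
proof (intro exI conjI allI impI)
  let ?R = "{x. complex_of_real x \<in> cycl N}" and ?M = "{x. complex_of_real x \<in> cycl_rad N}"
  show "dyadic_ideal ?R ?M"
    using one_notin_cycl_rad[OF assms(1)] cycl_rad_double[OF cycl_1[of N]]
    by unfold_locales
       (auto intro: cycl_add cycl_minus cycl_mult cycl_1 cycl_rad_add cycl_rad_mult cycl_rad_subset)
  fix t
  assume t: "cis t ^ N = 1" "cis t ^ 4 \<noteq> 1"
  define z where "z = cis t"
  have z: "z ^ N = 1" "z ^ 4 \<noteq> 1" "z \<noteq> 0" using t by (auto simp: z_def)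
  have "z ^ 4 = (z\<^sup>2)\<^sup>2" by (simp flip: power_mult)
  then have "(z\<^sup>2)\<^sup>2 \<noteq> 1" using z(2) by metis
  then have z2: "z\<^sup>2 \<noteq> 1 \<and> z\<^sup>2 \<noteq> -1" by (metis one_power2 power2_minus)
  define u where "u = 2 / (1 + z\<^sup>2)"
  have nz: "1 + z\<^sup>2 \<noteq> 0" using z2 by (metis add_eq_0_iff)
  obtain n where n: "N = 4 * n" using assms by blast
  \<comment> \<open>As \<open>N\<close> is even, \<open>- z^2\<close> is again an
    \<open>N\<close>-th root of unity; \<open>z ^ 4\<close> not being 1 keeps it away from 1 and
    -1.\<close>
  have "(- (z\<^sup>2)) ^ N = (z ^ N) ^ 2" using n by (simp add: power_minus_even mult.commute flip: power_mult)
  then have "2 / (1 - (- (z\<^sup>2))) \<in> cycl_rad N"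
    using z z2 assms by (intro double_inverse_one_minus_root) (auto, metis minus_minus)
  then have u: "u \<in> cycl_rad N" by (simp add: u_def)
  have "\<i> ^ N = 1" by (simp add: n power_mult)
  then have i: "\<i> \<in> cycl N" by (rule cycl_root)
  have cosz: "complex_of_real (cos t) = (z\<^sup>2 + 1) / (2 * z)"
    and sinz: "complex_of_real (sin t) = (z\<^sup>2 - 1) / (2 * \<i> * z)"
  proof -
    have cis: "z = cos t + \<i> * sin t" "1 / z = cos t - \<i> * sin t"
      by (auto simp: z_def complex_eq_iff Re_divide Im_divide)
    have "2 * complex_of_real (cos t) = z + 1 / z" using cis by simp
    then show "complex_of_real (cos t) = (z\<^sup>2 + 1) / (2 * z)"
      using z by (simp add: field_simps power2_eq_square)
    have "2 * \<i> * complex_of_real (sin t) = z - 1 / z" using cis by simp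
    then show "complex_of_real (sin t) = (z\<^sup>2 - 1) / (2 * \<i> * z)"
      using z by (simp add: field_simps power2_eq_square)
  qed
  have cos: "complex_of_real (1 / cos t) = u * z"
    by (simp add: cosz u_def add.commute)
  have tan: "complex_of_real (tan t) = - \<i> + \<i> * u"
    using nz z by (simp add: tan_def cosz sinz u_def add.commute) (simp add: field_simps)
  show cosM: "1 / cos t \<in> ?M"
    using cycl_rad_mult[OF u cycl_root[OF z(1)]] cos by simp
  show tanR: "tan t \<in> ?R"
    using cycl_add[OF cycl_minus[OF i] cycl_mult[OF i cycl_rad_subset[OF u]]] by (simp only: tan mem_Collect_eq)
  have "cos t \<noteq> 0" using cosz nz z by (auto simp: add.commute)
  \<comment> \<open>The identity \<open>1 + tan^2 = 1 / cos^2\<close> shows that the square lies in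
    the radical, which contains every ring element with a power in it.\<close>
  then have "(tan t - 1)\<^sup>2 = (1 / cos t) * (1 / cos t) + 2 * (- tan t)"
    using sin_cos_squared_add[of t]
    by (simp add: tan_def power2_eq_square field_simps)
  moreover have "complex_of_real ((1 / cos t) * (1 / cos t) + 2 * (- tan t)) \<in> cycl_rad N"
  proof -
    have "complex_of_real (1 / cos t) * complex_of_real (1 / cos t) + 2 * complex_of_real (- tan t) \<in> cycl_rad N"
      using cosM tanR
      by (intro cycl_rad_add cycl_rad_mult cycl_rad_double) (auto intro: cycl_rad_subset cycl_minus)
    then show ?thesis by (simp only: of_real_add of_real_mult of_real_numeral)
  qed
  ultimately have sq: "complex_of_real (tan t - 1) ^ 2 \<in> cycl_rad N"
    by (simp only: of_real_power[symmetric])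
  have "complex_of_real (tan t - 1) \<in> cycl N"
    using tanR by (auto intro: cycl_diff cycl_1)
  then show "tan t - 1 \<in> ?M"
    using cycl_rad_power[OF _ sq] by blast
qed

section \<open>Ping-pong modulo the prime above 2\<close>

lemma Rx_vec:
  "(Rx t *v w) $ 1 = w$1"
  "(Rx t *v w) $ 2 = cos t * w$2 - sin t * w$3"
  "(Rx t *v w) $ 3 = sin t * w$2 + cos t * w$3"
  by (simp_all add: matrix_vector_mult_def sum_3 Rx_def)

lemma Rz_vec:
  "(Rz t *v w) $ 1 = cos t * w$1 - sin t * w$2"
  "(Rz t *v w) $ 2 = sin t * w$1 + cos t * w$2"
  "(Rz t *v w) $ 3 = w$3"
  by (simp_all add: matrix_vector_mult_def sum_3 Rz_def)

lemma Rx_add: "Rx s ** Rx t = Rx (s + t)"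
  by (simp add: Rx_def vec_eq_iff forall_3 matrix_matrix_mult_def sum_3 cos_add sin_add algebra_simps)

lemma Rz_add: "Rz s ** Rz t = Rz (s + t)"
  by (simp add: Rz_def vec_eq_iff forall_3 matrix_matrix_mult_def sum_3 cos_add sin_add algebra_simps)

lemma cos_rational_eq_1:
  assumes "n > 0" "cos (2 * pi * of_int c / real n) = 1"
  shows "int n dvd c"
proof -
  obtain k :: int where k: "2 * pi * of_int c / real n = of_int k * (2 * pi)"
    using assms(2) by (auto simp only: cos_one_2pi_int mult.assoc)
  then have "real_of_int c = of_int k * real n" using assms(1) by (simp add: field_simps)
  then have "c = k * int n" by (metis of_int_eq_iff of_int_mult of_int_of_nat_eq)
  then show ?thesis by simp
qed

lemma cis_power_eq_1:
  assumes "n > 0" "cis (2 * pi * of_int c / real n) ^ m = 1"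
  shows "int n dvd int m * c"
proof -
  have "cis (2 * pi * of_int (int m * c) / real n) = 1"
    using assms(2) by (simp add: Complex.DeMoivre mult_ac)
  then have "cos (2 * pi * of_int (int m * c) / real n) = 1" by (simp add: complex_eq_iff)
  then show ?thesis using assms(1) cos_rational_eq_1 by blast
qed

lemma cis_power_multiple:
  assumes "n > 0" "n dvd m"
  shows "cis (2 * pi * of_int c / real n) ^ m = 1"
proof -
  obtain k where k: "m = n * k" using assms by blast
  have "real m * (2 * pi * of_int c / real n) = 2 * pi * of_int (int k * c)"
    using assms by (simp add: k)
  then show ?thesis by (simp only: Complex.DeMoivre cis_multiple_2pi Ints_of_int)
qed

context dyadic_ideal
begin

lemma R_diff: "x \<in> R \<Longrightarrow> y \<in> R \<Longrightarrow> x - y \<in> R"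
  using R_add[OF _ R_minus] by fastforce

lemma R_0: "0 \<in> R"
  using R_diff[OF R_1 R_1] by simp

lemma M_0: "0 \<in> M"
  using M_mult[OF M_2 R_0] by simp

lemma M_minus: "x \<in> M \<Longrightarrow> - x \<in> M"
  using M_mult[OF _ R_minus[OF R_1]] by fastforce

lemma M_diff: "x \<in> M \<Longrightarrow> y \<in> M \<Longrightarrow> x - y \<in> M"
  using M_add[OF _ M_minus] by fastforce

definition cong1 :: "real set" where
  "cong1 = {x. x - 1 \<in> M}"

lemma cong1_1: "1 \<in> cong1"
  by (simp add: cong1_def M_0)

lemma cong1_R: "x \<in> cong1 \<Longrightarrow> x \<in> R"
  unfolding cong1_def using R_add[OF M_R[of "x - 1"] R_1] by simp

lemma cong1_M: "x \<in> cong1 \<Longrightarrow> x \<notin> M"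
  unfolding cong1_def using M_diff[of x "x - 1"] M_1 by auto

lemma cong1_add: "x \<in> cong1 \<Longrightarrow> y \<in> M \<Longrightarrow> x + y \<in> cong1"
  unfolding cong1_def using M_add[of "x - 1" y] by (simp add: algebra_simps)

lemma cong1_minus: "x \<in> cong1 \<Longrightarrow> - x \<in> cong1"
  unfolding cong1_def using M_diff[OF M_minus[of "x - 1"] M_2] by (simp add: minus_diff_commute)

lemma cong1_mult: "x \<in> cong1 \<Longrightarrow> y \<in> cong1 \<Longrightarrow> x * y \<in> cong1"
  using M_add[of "(x - 1) * y" "y - 1"] M_mult[of "x - 1" y] cong1_R[of y]
  unfolding cong1_def by (simp add: algebra_simps)

text \<open>Up to a scalar \<open>1 / t\<close> with \<open>t \<in> M\<close>, vectors in \<open>tilt_B\<close> reduce modulo \<open>M\<close> to \<open>(1, 1, 0)\<close>,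
  the image of every generic rotation about the z-axis. The set \<open>tilt_A\<close> covers the two images of
  that vector under rotations about the x-axis: \<open>(0, 1, 1)\<close> for a generic angle and \<open>(1, 0, 1)\<close>
  for a quarter turn. Neither is annihilated by the functional \<open>x + y\<close>, so the next rotation about
  the z-axis leads back to \<open>tilt_B\<close>.\<close>

definition tilt_B :: "(real^3) set" where
  "tilt_B = {w. \<exists>t\<in>M. t * w$1 \<in> cong1 \<and> t * w$2 \<in> cong1 \<and> t * w$3 \<in> M}"

definition tilt_A :: "(real^3) set" where
  "tilt_A = {w. \<exists>t\<in>M. t * w$1 \<in> R \<and> t * w$2 \<in> R \<and> t * w$1 + t * w$2 \<in> cong1 \<and> t * w$3 \<in> cong1}"

definition R_vectors :: "(real^3) set" where
  "R_vectors = {w. \<forall>i. w$i \<in> R}"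

text \<open>Scaling a vector over \<open>R\<close> by \<open>t \<in> M\<close> puts every coordinate
  into \<open>M\<close>, but in both sets some scaled coordinate is congruent to 1.\<close>

lemma tilt_not_R_vectors: "w \<in> tilt_A \<union> tilt_B \<Longrightarrow> w \<notin> R_vectors"
proof
  assume "w \<in> tilt_A \<union> tilt_B" "w \<in> R_vectors"
  then obtain t i where "t \<in> M" "t * w$i \<in> cong1" "w$i \<in> R"
    unfolding tilt_A_def tilt_B_def R_vectors_def by blast
  then show False using M_mult[of t "w$i"] cong1_M by blast
qed

definition generic :: "real \<Rightarrow> bool" where
  "generic t \<longleftrightarrow> 1 / cos t \<in> M \<and> tan t \<in> R \<and> tan t - 1 \<in> M"

lemma generic_cos: "generic t \<Longrightarrow> cos t \<noteq> 0"
  unfolding generic_def tan_def using M_minus M_1 by fastforce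

lemma generic_tan: "generic t \<Longrightarrow> tan t \<in> cong1"
  by (simp add: generic_def cong1_def)

text \<open>The start of the ping-pong: after scaling by \<open>1 / cos t\<close> the image of the
  first basis vector is \<open>(1, tan t, 0)\<close>.\<close>

lemma Rz_axis_tilt_B:
  assumes "generic t"
  shows "Rz t *v axis 1 1 \<in> tilt_B"
proof -
  have "1 / cos t * sin t = tan t" by (simp add: tan_def)
  then show ?thesis
    unfolding tilt_B_def using assms generic_cos[OF assms] generic_tan[OF assms]
    by (intro CollectI bexI[of _ "1 / cos t"])
       (auto simp: Rz_vec axis_def cong1_1 M_0 generic_def)
qed

text \<open>\<open>Rz t / cos t\<close> maps \<open>(x, y, z)\<close> to
  \<open>(x - y * tan t, x * tan t + y, z / cos t)\<close>, which reduces to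
  \<open>(x + y, x + y, 0)\<close> since signs disappear modulo 2.\<close>

lemma Rz_tilt_B:
  assumes t: "generic t" and w: "w \<in> tilt_A"
  shows "Rz t *v w \<in> tilt_B"
proof -
  obtain s where s: "s \<in> M" "s * w$1 \<in> R" "s * w$2 \<in> R" "s * w$1 + s * w$2 \<in> cong1" "s * w$3 \<in> cong1"
    using w unfolding tilt_A_def by blast
  let ?s = "s * (1 / cos t)"
  note c = generic_cos[OF t]
  have m: "1 / cos t \<in> M" "tan t - 1 \<in> M" "1 / cos t \<in> R" using t M_R by (auto simp: generic_def)
  have "?s * (Rz t *v w)$1 = (s * w$1 + s * w$2) + (- ((tan t - 1) * (s * w$2)) - 2 * (s * w$2))"
    using c by (simp add: Rz_vec tan_def field_simps)
  moreover have "\<dots> \<in> cong1"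
    by (rule cong1_add[OF s(4) M_diff[OF M_minus[OF M_mult[OF m(2) s(3)]] M_mult[OF M_2 s(3)]]])
  moreover have "?s * (Rz t *v w)$2 = (s * w$1 + s * w$2) + (tan t - 1) * (s * w$1)"
    using c by (simp add: Rz_vec tan_def field_simps)
  moreover have "\<dots> \<in> cong1"
    by (rule cong1_add[OF s(4) M_mult[OF m(2) s(2)]])
  moreover have "?s * (Rz t *v w)$3 = 1 / cos t * (s * w$3)" by (simp add: Rz_vec)
  moreover have "\<dots> \<in> M" using s m by (intro M_mult cong1_R)
  moreover have "?s \<in> M" using s m by (intro M_mult)
  ultimately show ?thesis unfolding tilt_B_def by (intro CollectI bexI[of _ ?s]) auto
qed

text \<open>Dividing by \<open>cos t\<close> kills the first coordinate modulo \<open>M\<close> and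
  turns \<open>(1, 1, 0)\<close> into \<open>(0, 1, tan t)\<close>, which is congruent to
  \<open>(0, 1, 1)\<close>.\<close>

lemma Rx_tilt_A_generic:
  assumes t: "generic t" and w: "w \<in> tilt_B"
  shows "Rx t *v w \<in> tilt_A"
proof -
  obtain s where s: "s \<in> M" "s * w$1 \<in> cong1" "s * w$2 \<in> cong1" "s * w$3 \<in> M"
    using w unfolding tilt_B_def by blast
  let ?s = "s * (1 / cos t)"
  note c = generic_cos[OF t]
  have m: "1 / cos t \<in> M" "tan t \<in> R" "1 / cos t \<in> R" using t M_R by (auto simp: generic_def)
  have e1: "?s * (Rx t *v w)$1 = 1 / cos t * (s * w$1)" by (simp add: Rx_vec)
  have i1: "\<dots> \<in> M" using s m by (intro M_mult cong1_R)
  have e2: "?s * (Rx t *v w)$2 = s * w$2 + - (s * w$3 * tan t)"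
    using c by (simp add: Rx_vec tan_def field_simps)
  have i2: "\<dots> \<in> cong1" by (rule cong1_add[OF s(3) M_minus[OF M_mult[OF s(4) m(2)]]])
  have e3: "?s * (Rx t *v w)$3 = tan t * (s * w$2) + s * w$3"
    using c by (simp add: Rx_vec tan_def field_simps)
  have i3: "\<dots> \<in> cong1" by (rule cong1_add[OF cong1_mult[OF generic_tan[OF t] s(3)] s(4)])
  have e4: "?s * (Rx t *v w)$1 + ?s * (Rx t *v w)$2 \<in> cong1"
    using cong1_add[OF i2 i1] by (simp only: e1 e2 add.commute)
  have "?s \<in> M" using s m by (intro M_mult)
  then show ?thesis
    unfolding tilt_A_def using e4
    by (intro CollectI bexI[of _ ?s] conjI)
       (simp_all only: e1 e2 e3 i1 i2 i3 M_R cong1_R)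
qed

text \<open>A quarter turn exchanges the last two coordinates up to sign, so the same scalar
  \<open>s\<close> works.\<close>

lemma Rx_tilt_A_quarter:
  assumes t: "cos t = 0" and w: "w \<in> tilt_B"
  shows "Rx t *v w \<in> tilt_A"
proof -
  obtain s where s: "s \<in> M" "s * w$1 \<in> cong1" "s * w$2 \<in> cong1" "s * w$3 \<in> M"
    using w unfolding tilt_B_def by blast
  have "(sin t)\<^sup>2 = 1" using t sin_cos_squared_add[of t] by simp
  then have "sin t = 1 \<or> sin t = -1" by (simp add: power2_eq_1_iff)
  then have "s * (Rx t *v w)$3 \<in> cong1" "s * (Rx t *v w)$2 \<in> M"
    using s t cong1_minus[OF s(3)] M_minus[OF s(4)] by (auto simp: Rx_vec)
  then show ?thesis
    unfolding tilt_A_def using s by (intro CollectI bexI[of _ s]) (auto simp: Rx_vec M_R cong1_R cong1_add)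
qed

text \<open>Only signs change. This serves the first exponent of \<open>A\<close> in a word, which
  may be a multiple of a half turn.\<close>

lemma Rx_tilt_B_half:
  assumes t: "sin t = 0" and w: "w \<in> tilt_B"
  shows "Rx t *v w \<in> tilt_B"
proof -
  obtain s where s: "s \<in> M" "s * w$1 \<in> cong1" "s * w$2 \<in> cong1" "s * w$3 \<in> M"
    using w unfolding tilt_B_def by blast
  have "(cos t)\<^sup>2 = 1" using t sin_cos_squared_add[of t] by simp
  then have "cos t = 1 \<or> cos t = -1" by (simp add: power2_eq_1_iff)
  then have "s * (Rx t *v w)$2 \<in> cong1" "s * (Rx t *v w)$3 \<in> M"
    using s t cong1_minus[OF s(3)] M_minus[OF s(4)] by (auto simp: Rx_vec)
  then show ?thesis
    unfolding tilt_B_def using s by (intro CollectI bexI[of _ s]) (auto simp: Rx_vec)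
qed

end

section \<open>Powers of the two rotations and their half turns\<close>

locale even_rotation_pair =
  fixes p q :: nat
  assumes p3: "p \<ge> 3" and q3: "q \<ge> 3" and even_p: "even p" and q4: "\<not> 4 dvd q"
begin

definition A :: "int \<Rightarrow> real^3^3" where
  "A a = Rx (2 * pi * of_int a / real p)"

definition B :: "int \<Rightarrow> real^3^3" where
  "B b = Rz (2 * pi * of_int b / real q)"

definition hA :: int where
  "hA = int p div 2"

text \<open>For odd \<open>q\<close> no power of \<open>B\<close> is a half turn, so only the trivial powers of \<open>B\<close> are amalgamated.\<close>

definition hB :: int where
  "hB = (if even q then int q div 2 else int q)"

text \<open>Conjugation by the half turn \<open>A hA\<close> inverts every power of
  \<open>B\<close>.\<close>

definition twist_A :: "int \<Rightarrow> int \<Rightarrow> int" where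
  "twist_A m b = (if odd m then - b else b)"

text \<open>For odd \<open>q\<close> the matrix \<open>B (hB * k)\<close> is the identity and
  conjugation by it is trivial; hence the condition \<open>even q\<close>.\<close>

definition twist_B :: "int \<Rightarrow> int \<Rightarrow> int" where
  "twist_B k a = (if even q \<and> odd k then - a else a)"

fun val :: "(int \<times> int) list \<Rightarrow> real^3^3" where
  "val [] = mat 1"
| "val ((a, b) # ws) = A a ** B b ** val ws"

lemma A_add: "A a ** A b = A (a + b)"
  unfolding A_def Rx_add by (simp add: add_divide_distrib distrib_left)

lemma B_add: "B a ** B b = B (a + b)"
  unfolding B_def Rz_add by (simp add: add_divide_distrib distrib_left)

lemma A_0: "A 0 = mat 1"
  by (simp add: A_def Rx_def vec_eq_iff forall_3 mat_def)

lemma B_0: "B 0 = mat 1"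
  by (simp add: B_def Rz_def vec_eq_iff forall_3 mat_def)

lemma p_eq: "int p = 2 * hA"
  using even_p by (auto simp: hA_def elim!: evenE)

lemma q_eq: "even q \<Longrightarrow> int q = 2 * hB"
  by (auto simp: hB_def elim!: evenE)

lemma A_half: "cos (2 * pi * of_int (hA * m) / real p) = (if even m then 1 else -1)"
  "sin (2 * pi * of_int (hA * m) / real p) = 0"
proof -
  have "real p = 2 * of_int hA" using p_eq by (metis of_int_mult of_int_numeral of_int_of_nat_eq)
  moreover have "hA \<noteq> 0" using p_eq p3 by auto
  ultimately have "2 * pi * of_int (hA * m) / real p = of_int m * pi" by simp
  then show "cos (2 * pi * of_int (hA * m) / real p) = (if even m then 1 else -1)"
    "sin (2 * pi * of_int (hA * m) / real p) = 0"
    by (auto simp: mult.commute[of _ pi] cos_npi_int sin_npi_int)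
qed

lemma B_half: "cos (2 * pi * of_int (hB * m) / real q) = (if even m \<or> odd q then 1 else -1)"
  "sin (2 * pi * of_int (hB * m) / real q) = 0"
proof -
  have "2 * pi * of_int (hB * m) / real q = of_int (if even q then m else 2 * m) * pi"
  proof (cases "even q")
    case True
    then have "real q = 2 * of_int hB" using q_eq by (metis of_int_mult of_int_numeral of_int_of_nat_eq)
    moreover have "hB \<noteq> 0" using q_eq[OF True] q3 by auto
    ultimately show ?thesis using True by simp
  next
    case False
    then show ?thesis using q3 by (simp add: hB_def)
  qed
  then show "cos (2 * pi * of_int (hB * m) / real q) = (if even m \<or> odd q then 1 else -1)"
    "sin (2 * pi * of_int (hB * m) / real q) = 0"
    by (auto simp: mult.commute[of _ pi] cos_npi_int sin_npi_int split: if_splits)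
qed

lemma A_half_B: "A (hA * m) ** B b = B (twist_A m b) ** A (hA * m)"
  unfolding twist_A_def A_def B_def Rx_def Rz_def A_half
  by (simp add: vec_eq_iff forall_3 matrix_matrix_mult_def sum_3)

lemma B_half_A: "B (hB * k) ** A a = A (twist_B k a) ** B (hB * k)"
  unfolding twist_B_def A_def B_def Rx_def Rz_def B_half
  by (simp add: vec_eq_iff forall_3 matrix_matrix_mult_def sum_3)

text \<open>A rotation about both axes is the identity; the diagonal entries detect this.\<close>

lemma A_B_unique:
  assumes "A a ** B b = A a' ** B b'"
  shows "int p dvd a' - a" "int q dvd b' - b"
proof -
  have "A (- a) ** (A a ** B b) ** B (- b') = A (- a) ** (A a' ** B b') ** B (- b')"
    using assms by simp
  then have eq: "B (b - b') = A (a' - a)"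
    by (simp add: matrix_mul_assoc A_add A_0)
       (simp add: matrix_mul_assoc[symmetric] B_add B_0)
  have "cos (2 * pi * of_int (a' - a) / real p) = 1"
    using arg_cong[OF eq, of "\<lambda>M. M$3$3"] by (simp add: A_def B_def Rx_def Rz_def)
  then show "int p dvd a' - a" using p3 by (intro cos_rational_eq_1) auto
  have "cos (2 * pi * of_int (b - b') / real q) = 1"
    using arg_cong[OF eq, of "\<lambda>M. M$1$1"] by (simp add: A_def B_def Rx_def Rz_def)
  then have "int q dvd b - b'" using q3 by (intro cos_rational_eq_1) auto
  then show "int q dvd b' - b" by (simp add: dvd_diff_commute)
qed

lemma A_period: "int p dvd a \<Longrightarrow> A a = mat 1"
proof -
  assume "int p dvd a"
  then obtain k where k: "a = hA * (2 * k)" unfolding p_eq by (auto simp: dvd_def mult_ac)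
  show ?thesis unfolding k A_def Rx_def A_half by (simp add: vec_eq_iff forall_3 mat_def)
qed

lemma B_period: "int q dvd b \<Longrightarrow> B b = mat 1"
proof -
  assume b: "int q dvd b"
  have "\<exists>k. b = hB * k \<and> (even k \<or> odd q)"
  proof (cases "even q")
    case True
    then obtain k where "b = hB * (2 * k)" using b unfolding q_eq[OF True] by (auto simp: dvd_def mult_ac)
    then show ?thesis by (intro exI[of _ "2 * k"]) auto
  qed (use b in \<open>auto simp: hB_def\<close>)
  then obtain k where k: "b = hB * k" "even k \<or> odd q" by blast
  show ?thesis unfolding k B_def Rz_def B_half using k by (auto simp add: vec_eq_iff forall_3 mat_def)
qed

text \<open>Unlike for reduced words below, the last exponent of \<open>B\<close> must be nontrivial as well;
  the first exponent of \<open>A\<close> is arbitrary in both cases.\<close>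

fun proper :: "(int \<times> int) list \<Rightarrow> bool" where
  "proper [] \<longleftrightarrow> False"
| "proper [(a, b)] \<longleftrightarrow> \<not> hB dvd b"
| "proper ((a, b) # (a', b') # ws) \<longleftrightarrow> \<not> hB dvd b \<and> \<not> hA dvd a' \<and> proper ((a', b') # ws)"

text \<open>The word moves the first basis vector out of \<open>R_vectors\<close>, while
  \<open>A c ** B (hB * k)\<close> sends it to itself or to its negative.\<close>

lemma proper_not_dihedral:
  assumes "proper ws"
  shows "val ws \<noteq> A c ** B (hB * k)"
proof -
  \<comment> \<open>With this exponent the \<open>cis\<close> values of all angles in the word are
    roots of unity, and the factor 4 meets the divisibility hypothesis.\<close>
  have "4 * p * q > 0" "4 dvd 4 * p * q" using p3 q3 by auto
  from exists_dyadic_ideal[OF this] obtain R M where "dyadic_ideal R M" and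
    RM: "\<And>t. cis t ^ (4 * p * q) = 1 \<Longrightarrow> cis t ^ 4 \<noteq> 1 \<Longrightarrow> 1 / cos t \<in> M \<and> tan t \<in> R \<and> tan t - 1 \<in> M"
    by blast
  then interpret dyadic_ideal R M by blast
  have gB: "generic (2 * pi * of_int b / real q)" if "\<not> hB dvd b" for b
  proof -
    \<comment> \<open>There are no quarter turns about the z-axis: \<open>hB\<close> is odd because
      4 does not divide \<open>q\<close>, so the powers of 2 cancel.\<close>
    have "\<not> int q dvd 4 * b"
    proof
      assume d: "int q dvd 4 * b"
      have "hB dvd b"
      proof (cases "even q")
        case True
        then have "hB dvd 2 * b" using d q_eq by auto
        moreover have "odd hB" using q4 q_eq[OF True] by presburger
        ultimately show ?thesis by (simp add: coprime_dvd_mult_right_iff)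
      next
        case False
        then have "coprime (int q) 4" using coprime_power_right_iff[of "int q" 2 2] by simp
        then show ?thesis using d False by (simp add: coprime_dvd_mult_right_iff hB_def)
      qed
      then show False using that by simp
    qed
    then show ?thesis
      unfolding generic_def using q3 cis_power_eq_1[of q b 4]
      by (intro RM cis_power_multiple) auto
  qed
  have AB: "A a *v w \<in> tilt_A" if "\<not> hA dvd a" "w \<in> tilt_B" for a w
  proof (cases "cos (2 * pi * of_int a / real p) = 0")
    case True
    then show ?thesis unfolding A_def using Rx_tilt_A_quarter that by blast
  next
    case False
    let ?t = "2 * pi * of_int a / real p"
    \<comment> \<open>Otherwise the angle would be an odd number of quarter turns, with vanishing
      cosine.\<close>
    have "cis ?t ^ 4 \<noteq> 1"
    proof
      assume "cis ?t ^ 4 = 1"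
      then have "int p dvd 4 * a" using cis_power_eq_1[of p a 4] p3 by simp
      then obtain l where "4 * a = int p * l" by blast
      then have l: "2 * a = hA * l" using p_eq by simp
      have "odd l" using l that by auto
      have hA0: "hA \<noteq> 0" using p_eq p3 by auto
      have p_real: "real p = 2 * of_int hA" using p_eq by (metis of_int_mult of_int_numeral of_int_of_nat_eq)
      have "2 * real_of_int a = of_int hA * of_int l" using l by (metis of_int_mult of_int_numeral)
      then have "?t = of_int l * pi / 2" using hA0 p_real by (simp add: field_simps)
      then have "cos ?t = 0" using \<open>odd l\<close> cos_zero_iff_int by auto
      then show False using False by simp
    qed
    then have "generic ?t"
      unfolding generic_def using p3 by (intro RM cis_power_multiple) auto
    then show ?thesis unfolding A_def using Rx_tilt_A_generic that by blast
  qed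
  have AB': "A a *v w \<in> tilt_A \<union> tilt_B" if "w \<in> tilt_B" for a w
  proof (cases "hA dvd a")
    case True
    then show ?thesis unfolding A_def using Rx_tilt_B_half that A_half(2) by (auto elim!: dvdE)
  qed (use AB that in blast)
  \<comment> \<open>The second conjunct drives the induction, since \<open>Rz_tilt_B\<close> starts
    from \<open>tilt_A\<close>; the first also covers a leading exponent divisible by
    \<open>hA\<close>.\<close>
  have "val ws *v axis 1 1 \<in> tilt_A \<union> tilt_B \<and>
    (\<not> hA dvd fst (hd ws) \<longrightarrow> val ws *v axis 1 1 \<in> tilt_A)"
    using assms
  proof (induction ws rule: proper.induct)
    case (2 a b)
    have "B b *v axis 1 1 \<in> tilt_B" unfolding B_def using 2 by (intro Rz_axis_tilt_B gB) simp
    then show ?case using AB AB' by (simp flip: matrix_vector_mul_assoc)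
  next
    case (3 a b a' b' ws)
    then have "val ((a', b') # ws) *v axis 1 1 \<in> tilt_A" by simp
    then have "B b *v (val ((a', b') # ws) *v axis 1 1) \<in> tilt_B"
      unfolding B_def using 3 by (intro Rz_tilt_B gB) auto
    then have "A a *v (B b *v (val ((a', b') # ws) *v axis 1 1)) \<in> tilt_A \<union> tilt_B \<and>
      (\<not> hA dvd a \<longrightarrow> A a *v (B b *v (val ((a', b') # ws) *v axis 1 1)) \<in> tilt_A)"
      using AB AB' by blast
    moreover have "val ((a, b) # (a', b') # ws) *v axis 1 1
      = A a *v (B b *v (val ((a', b') # ws) *v axis 1 1))"
      by (simp add: matrix_vector_mul_assoc matrix_mul_assoc)
    ultimately show ?case by (simp only: list.sel fst_conv) simp
  qed simp
  then have "val ws *v axis 1 1 \<notin> R_vectors" using tilt_not_R_vectors by blast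
  moreover have "(A c ** B (hB * k)) *v axis 1 1 \<in> R_vectors"
    unfolding matrix_vector_mul_assoc[symmetric] R_vectors_def forall_3 mem_Collect_eq A_def B_def Rx_vec Rz_vec B_half
    by (auto simp: axis_def R_0 R_1 R_minus)
  ultimately show ?thesis by auto
qed

section \<open>Reduced words in the amalgamated product\<close>

lemma twist_simps [simp]:
  "twist_A m (twist_A m b) = b" "twist_B k (twist_B k a) = a"
  "h dvd twist_A m b \<longleftrightarrow> h dvd b" "h dvd twist_B k a \<longleftrightarrow> h dvd a"
  "\<bar>twist_A m b\<bar> = \<bar>b\<bar>"
  by (auto simp: twist_A_def twist_B_def)

lemma A_add_left: "A a ** (A b ** X) = A (a + b) ** X"
  by (simp add: matrix_mul_assoc A_add)

lemma B_add_left: "B a ** (B b ** X) = B (a + b) ** X"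
  by (simp add: matrix_mul_assoc B_add)

lemmas word_simps = matrix_mul_assoc[symmetric] A_add B_add A_add_left B_add_left A_0 B_0

lemma B_A_half: "B b ** A (hA * m) = A (hA * m) ** B (twist_A m b)"
  using A_half_B[of m "twist_A m b"] by simp

lemma A_B_half: "A a ** B (hB * k) = B (hB * k) ** A (twist_B k a)"
  using B_half_A[of k "twist_B k a"] by simp

lemma B_A_half_left: "B b ** (A (hA * m) ** X) = A (hA * m) ** (B (twist_A m b) ** X)"
  by (simp add: matrix_mul_assoc B_A_half)

lemma B_half_A_left: "B (hB * k) ** (A a ** X) = A (twist_B k a) ** (B (hB * k) ** X)"
  by (simp add: matrix_mul_assoc B_half_A)

lemma val_append: "val (us @ vs) = val us ** val vs"
  by (induction us rule: val.induct) (auto simp: matrix_mul_assoc)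

lemma val_inverse: "\<exists>Y. Y ** val ws = mat 1 \<and> val ws ** Y = mat 1"
proof (induction ws rule: val.induct)
  case 1
  then show ?case by (intro exI[of _ "mat 1"]) simp
next
  case (2 a b ws)
  then obtain Y where "Y ** val ws = mat 1" "val ws ** Y = mat 1" by blast
  then have "(Y ** (B (- b) ** A (- a))) ** val ((a, b) # ws) = mat 1"
    by (simp add: word_simps)
  then show ?case using matrix_left_right_inverse by blast
qed

lemma val_right_cancel: "X ** val ws = Y ** val ws \<Longrightarrow> X = Y"
  using val_inverse[of ws] by (metis matrix_mul_assoc matrix_mul_rid)

lemma val_left_cancel: "val ws ** X = val ws ** Y \<Longrightarrow> X = Y"
  using val_inverse[of ws] by (metis matrix_mul_assoc matrix_mul_lid)

lemma proper_iff:
  "proper ws \<longleftrightarrow> ws \<noteq> [] \<and> (\<forall>x\<in>set (tl ws). \<not> hA dvd fst x) \<and> (\<forall>x\<in>set ws. \<not> hB dvd snd x)"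
  by (induction ws rule: proper.induct) auto

lemma proper_append:
  "us \<noteq> [] \<Longrightarrow> vs \<noteq> [] \<Longrightarrow>
    proper (us @ vs) \<longleftrightarrow> proper us \<and> \<not> hA dvd fst (hd vs) \<and> proper vs"
  by (cases us; cases vs) (auto simp: proper_iff)

text \<open>\<open>inverse_word c ws\<close> spells \<open>A c\<close> times the inverse of \<open>val ws\<close>,
  up to the trailing power of \<open>A\<close> coming from the first letter of \<open>ws\<close>.\<close>

fun inverse_word :: "int \<Rightarrow> (int \<times> int) list \<Rightarrow> (int \<times> int) list" where
  "inverse_word c [] = []"
| "inverse_word c [(a, b)] = [(c, - b)]"
| "inverse_word c ((a, b) # (a', b') # ws) = inverse_word c ((a', b') # ws) @ [(- a', - b)]"

lemma inverse_word_val: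
  "ws \<noteq> [] \<Longrightarrow> val (inverse_word c ws) ** A (- fst (hd ws)) ** val ws = A c"
proof (induction c ws rule: inverse_word.induct)
  case (3 c a b a' b' ws)
  then show ?case by (simp add: val_append word_simps)
qed (simp_all add: word_simps)

lemma inverse_word_eq_Nil: "inverse_word c ws = [] \<longleftrightarrow> ws = []"
  by (induction c ws rule: inverse_word.induct) auto

lemma inverse_word_proper:
  "proper ws \<Longrightarrow> proper (inverse_word c ws) \<and> fst (hd (inverse_word c ws)) = c"
proof (induction c ws rule: inverse_word.induct)
  case (3 c a b a' b' ws)
  then show ?case by (simp add: proper_append inverse_word_eq_Nil hd_append)
qed simp_all

text \<open>If \<open>hA\<close> did not divide \<open>c\<close>, then \<open>us\<close> followed by
  the inverse of \<open>vs\<close> would be a proper word whose value is a power of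
  \<open>A\<close>, against \<open>proper_not_dihedral\<close>.\<close>

lemma proper_overlap:
  assumes us: "us = [] \<or> proper us" and vs: "vs = [] \<or> proper vs"
    and eq: "val us ** A c = val vs"
  shows "us = [] \<longleftrightarrow> vs = []" "us \<noteq> [] \<Longrightarrow> hA dvd c"
proof -
  have not_A: "\<not> proper ws" if "val ws = A d" for ws d
    using proper_not_dihedral[of ws d 0] that by (auto simp: B_0)
  show iff: "us = [] \<longleftrightarrow> vs = []"
  proof
    assume "us = []"
    then show "vs = []" using eq vs not_A[of vs c] by auto
  next
    assume "vs = []"
    then have "val us ** A c ** A (- c) = A (- c)" using eq by simp
    then have "val us = A (- c)" by (simp add: word_simps)
    then show "us = []" using us not_A by blast
  qed
  assume "us \<noteq> []"
  then have p: "proper us" "proper vs" "vs \<noteq> []" using us vs iff by auto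
  show "hA dvd c"
  proof (rule ccontr)
    assume c: "\<not> hA dvd c"
    let ?w = "us @ inverse_word c vs"
    have w: "proper ?w"
      using p c \<open>us \<noteq> []\<close> inverse_word_proper[of vs c] inverse_word_eq_Nil[of c vs]
      by (simp add: proper_append)
    have "val ?w ** A (- fst (hd vs)) ** val vs = val us ** A c"
      using inverse_word_val[OF p(3), of c] by (simp add: val_append word_simps)
    also have "\<dots> = mat 1 ** val vs" using eq by simp
    finally have "val ?w ** A (- fst (hd vs)) = mat 1" by (rule val_right_cancel)
    then have "val ?w ** A (- fst (hd vs)) ** A (fst (hd vs)) = A (fst (hd vs))" by simp
    then have "val ?w = A (fst (hd vs))" by (simp add: word_simps)
    then show False using w not_A by blast
  qed
qed

text \<open>Reduced words of an amalgamated product; the two outermost exponents, the first of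
  \<open>A\<close> and the last of \<open>B\<close>, stay free.\<close>

definition reduced :: "(int \<times> int) list \<Rightarrow> bool" where
  "reduced ws \<longleftrightarrow> ws \<noteq> [] \<and> (\<forall>x\<in>set (tl ws). \<not> hA dvd fst x) \<and> (\<forall>x\<in>set (butlast ws). \<not> hB dvd snd x)"

lemma reduced_snoc:
  "reduced (us @ [(a, b)]) \<longleftrightarrow> us = [] \<or> (proper us \<and> \<not> hA dvd a)"
  by (cases us) (auto simp: reduced_def proper_iff)

lemma reduced_Cons:
  "reduced ((a, b) # w # ws) \<longleftrightarrow> \<not> hB dvd b \<and> \<not> hA dvd fst w \<and> reduced (w # ws)"
  by (auto simp: reduced_def)

lemma reduced_fst: "reduced ((a, b) # ws) \<longleftrightarrow> reduced ((a', b) # ws)"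
  by (auto simp: reduced_def)

lemma proper_reduced: "proper ws \<Longrightarrow> reduced ws"
  by (auto simp: reduced_def proper_iff dest: in_set_butlastD)

text \<open>The amalgamated subgroup: a Klein four-group if \<open>q\<close> is even, of order 2 if \<open>q\<close> is odd.\<close>

definition klein :: "int \<Rightarrow> int \<Rightarrow> real^3^3" where
  "klein m k = A (hA * m) ** B (hB * k)"

lemma klein_0: "klein 0 0 = mat 1"
  by (simp add: klein_def word_simps)

lemma pair_klein: "A a ** B b ** klein m k = A (a + hA * m) ** B (twist_A m b + hB * k)"
  by (simp add: klein_def word_simps B_A_half_left)

lemma klein_pair: "klein m k ** (A a ** B b) = A (hA * m + twist_B k a) ** B (hB * k + b)"
  by (simp add: klein_def word_simps B_half_A_left)

text \<open>The normal form theorem for amalgamated products, by induction from the right. The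
  factor \<open>klein m k\<close> is part of the hypothesis because stripping the last pairs leaves
  such a factor behind.\<close>

lemma reduced_prefixes:
  assumes "reduced ws" "reduced ws'" "val ws ** klein m k = val ws'"
  shows "length ws = length ws' \<and> (\<forall>i. \<exists>m k. val (take i ws) ** klein m k = val (take i ws'))"
  using assms
proof (induction ws arbitrary: ws' m k rule: rev_induct)
  case Nil
  then show ?case by (simp add: reduced_def)
next
  case (snoc x us)
  obtain a b where x: "x = (a, b)" by (cases x)
  obtain vs a' b' where ws': "ws' = vs @ [(a', b')]"
    using snoc.prems(2) by (metis rev_exhaust reduced_def surj_pair)
  have us: "us = [] \<or> proper us \<and> \<not> hA dvd a" and vs: "vs = [] \<or> proper vs \<and> \<not> hA dvd a'"
    using snoc.prems x ws' by (simp_all add: reduced_snoc)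
  \<comment> \<open>The Klein factor is absorbed into the last pair, which changes \<open>a\<close>
    by a multiple of \<open>hA\<close>.\<close>
  define a1 b1 where "a1 = a + hA * m" and "b1 = twist_A m b + hB * k"
  have a1: "hA dvd a1 \<longleftrightarrow> hA dvd a" by (simp add: a1_def dvd_add_left_iff)
  have "val us ** (A a ** B b ** klein m k) = val vs ** (A a' ** B b')"
    using snoc.prems(3) by (simp add: x ws' val_append matrix_mul_assoc)
  then have eq: "val us ** (A a1 ** B b1) = val vs ** (A a' ** B b')"
    by (simp add: pair_klein a1_def b1_def)
  have "val us ** (A a1 ** B b1) ** (B (- b') ** A (- a')) = val vs ** (A a' ** B b') ** (B (- b') ** A (- a'))"
    using eq by simp
  then have eq1: "val (us @ [(a1, b1 - b')]) ** A (- a') = val vs"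
    by (simp add: val_append word_simps)
  \<comment> \<open>Otherwise the word in \<open>eq1\<close> would be proper, and
    \<open>proper_overlap\<close> would make \<open>hA\<close> divide \<open>a'\<close>.\<close>
  have "hB dvd b1 - b'"
  proof (rule ccontr)
    assume "\<not> hB dvd b1 - b'"
    then have "proper (us @ [(a1, b1 - b')])"
      using us a1 by (cases "us = []") (auto simp: proper_append)
    then have "vs \<noteq> []" "hA dvd - a'"
      using proper_overlap[OF disjI2 _ eq1] vs by auto
    then show False using vs by simp
  qed
  then obtain l where l: "b1 - b' = hB * l" by blast
  define c where "c = twist_B l a1 - a'"
  have eq2: "val us ** B (hB * l) ** A c = val vs"
  proof -
    have "A a1 ** B (hB * l) ** A (- a') = B (hB * l) ** A c"
      by (simp only: A_B_half) (simp add: c_def word_simps)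
    then show ?thesis using eq1 by (simp add: val_append word_simps l)
  qed
  have rel: "\<exists>m k. val (take i (us @ [x])) ** klein m k = val (take i ws')"
    if "length us = length vs" "i \<le> length us \<Longrightarrow> \<exists>m k. val (take i us) ** klein m k = val (take i vs)" for i
  proof (cases "i \<le> length us")
    case False
    then have "take i (us @ [x]) = us @ [x]" "take i ws' = ws'" using that ws' by auto
    then show ?thesis using snoc.prems(3) by auto
  qed (use that ws' in auto)
  show ?case
  proof (cases "us = []")
    case True
    have "vs = []"
    proof (rule ccontr)
      assume "vs \<noteq> []"
      then have "proper vs" using vs by blast
      moreover have "val vs = A (twist_B l c) ** B (hB * l)"
        using eq2 True by (simp add: B_half_A)
      ultimately show False using proper_not_dihedral by blast
    qed
    moreover have "\<exists>m k. klein m k = mat 1" using klein_0 by blast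
    ultimately show ?thesis using True ws' rel by auto
  next
    case False
    then obtain us0 a0 b0 where us0: "us = us0 @ [(a0, b0)]" by (metis rev_exhaust surj_pair)
    have pus: "proper us" using us False by blast
    \<comment> \<open>The last exponent of \<open>B\<close> in \<open>us\<close> absorbs
      \<open>B (hB * l)\<close>; its residue modulo \<open>hB\<close> is unchanged, so the word
      stays proper.\<close>
    let ?us1 = "us0 @ [(a0, b0 + hB * l)]"
    have "proper ?us1"
      using pus us0 by (cases "us0 = []") (auto simp: proper_append dvd_add_left_iff)
    moreover have "val ?us1 ** A c = val vs"
      using eq2 by (simp add: us0 val_append word_simps)
    ultimately have "vs \<noteq> []" "hA dvd c"
      using proper_overlap[of ?us1 vs c] vs by auto
    then obtain n where n: "c = hA * n" and pvs: "proper vs" using vs by blast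
    \<comment> \<open>What is left between \<open>us\<close> and \<open>vs\<close> lies in the
      amalgamated subgroup again, as the induction hypothesis demands.\<close>
    have "val us ** klein n (twist_A n l) = val us ** (B (hB * l) ** A c)"
      by (simp add: klein_def n B_A_half twist_A_def)
    then have "val us ** klein n (twist_A n l) = val vs" using eq2 by (simp add: word_simps)
    then have "length us = length vs \<and> (\<forall>i. \<exists>m k. val (take i us) ** klein m k = val (take i vs))"
      using snoc.IH pus pvs proper_reduced by blast
    then show ?thesis using rel ws' by simp
  qed
qed

text \<open>Prefixes of length 1: the first pair is peeled off and the Klein element passes to the
  rest. Used for the R- and C-forms.\<close>

lemma reduced_Cons_eq:
  assumes "reduced ((a, b) # ws)" "reduced ((a', b') # ws')"
    and eq: "val ((a, b) # ws) = val ((a', b') # ws')"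
  shows "length ws = length ws'"
    "\<exists>m k. int p dvd a' - (a + hA * m) \<and> int q dvd b' - (twist_A m b + hB * k) \<and>
      val ws = klein m k ** val ws'"
proof -
  have *: "length ((a, b) # ws) = length ((a', b') # ws') \<and>
    (\<forall>i. \<exists>m k. val (take i ((a, b) # ws)) ** klein m k = val (take i ((a', b') # ws')))"
    using assms by (intro reduced_prefixes[where m = 0 and k = 0]) (simp_all add: klein_0)
  then show "length ws = length ws'" by simp
  obtain m k where mk: "val [(a, b)] ** klein m k = val [(a', b')]"
    using spec[OF conjunct2[OF *], of 1] by auto
  then have "A (a + hA * m) ** B (twist_A m b + hB * k) = A a' ** B b'"
    by (simp add: pair_klein)
  note dvd = A_B_unique[OF this]
  have "val [(a, b)] ** val ws = val [(a, b)] ** (klein m k ** val ws')"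
    using eq mk by (simp add: matrix_mul_assoc)
  then have "val ws = klein m k ** val ws'" by (rule val_left_cancel)
  then show "\<exists>m k. int p dvd a' - (a + hA * m) \<and> int q dvd b' - (twist_A m b + hB * k) \<and>
      val ws = klein m k ** val ws'"
    using dvd by blast
qed

text \<open>The counterpart that peels off the last pair, used for the L-form.\<close>

lemma reduced_snoc_eq:
  assumes "reduced (us @ [(a, b)])" "reduced (vs @ [(a', b')])"
    and eq: "val (us @ [(a, b)]) = val (vs @ [(a', b')])"
  shows "length us = length vs"
    "\<exists>m k. int p dvd hA * m + twist_B k a' - a \<and> int q dvd hB * k + b' - b \<and>
      val us ** klein m k = val vs"
proof -
  have *: "length (us @ [(a, b)]) = length (vs @ [(a', b')]) \<and>
    (\<forall>i. \<exists>m k. val (take i (us @ [(a, b)])) ** klein m k = val (take i (vs @ [(a', b')])))"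
    using assms by (intro reduced_prefixes[where m = 0 and k = 0]) (simp_all add: klein_0)
  then show len: "length us = length vs" by simp
  obtain m k where mk: "val us ** klein m k = val vs"
    using spec[OF conjunct2[OF *], of "length us"] len by auto
  have "val us ** (A a ** B b) = val us ** (klein m k ** (A a' ** B b'))"
    using eq by (simp add: val_append matrix_mul_assoc mk)
  then have "A a ** B b = klein m k ** (A a' ** B b')" by (rule val_left_cancel)
  then have "A a ** B b = A (hA * m + twist_B k a') ** B (hB * k + b')"
    by (simp add: klein_pair)
  from A_B_unique[OF this] mk
  show "\<exists>m k. int p dvd hA * m + twist_B k a' - a \<and> int q dvd hB * k + b' - b \<and>
      val us ** klein m k = val vs" by blast
qed

section \<open>Uniqueness of canonical forms\<close>

lemma half_pos: "hA > 0" "hB > 0"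
  using p_eq p3 q3 by (auto simp: hB_def)

lemma hB_dvd_q: "hB dvd int q"
  by (metis dvd_refl dvd_triv_right hB_def q_eq)

lemma hA_dvd_p: "hA dvd int p"
  by (simp add: p_eq)

text \<open>Oddness makes \<open>B_range\<close> a complete residue system modulo \<open>hB\<close>
  that is symmetric about 0.\<close>

lemma odd_hB: "odd hB"
proof (cases "even q")
  case True
  then show ?thesis using q4 q_eq[OF True] by presburger
qed (simp add: hB_def)

lemma full_range_iff: "k \<in> full_range m \<longleftrightarrow> - int m < 2 * k \<and> 2 * k \<le> int m"
  unfolding full_range_def by (auto simp: field_simps)

lemma A_range_iff: "a \<in> A_range p \<longleftrightarrow> - hA < 2 * a \<and> 2 * a \<le> hA"
proof -
  have "real p = 2 * of_int hA" using p_eq by (metis of_int_mult of_int_numeral of_int_of_nat_eq)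
  then show ?thesis unfolding A_range_def by (auto simp: field_simps)
qed

text \<open>The choice \<open>hB = q\<close> for odd \<open>q\<close> merges both cases into one
  condition, visibly stable under \<open>twist_A\<close>.\<close>

lemma B_range_iff: "b \<in> B_range q \<longleftrightarrow> 2 * \<bar>b\<bar> < hB"
proof (cases "even q")
  case True
  then have "real q = 2 * of_int hB" using q_eq by (metis of_int_mult of_int_numeral of_int_of_nat_eq)
  then show ?thesis using True unfolding B_range_def by (auto simp: field_simps)
next
  case False
  then show ?thesis unfolding B_range_def hB_def by (auto simp: field_simps)
qed

lemma dvd_small_eq:
  fixes x y h :: int
  assumes "h dvd x - y" "\<bar>x - y\<bar> < h"
  shows "x = y"
  using dvd_imp_le_int[of "x - y" h] assms by fastforce

lemma A_range_unique: "x \<in> A_range p \<Longrightarrow> y \<in> A_range p \<Longrightarrow> hA dvd x - y \<Longrightarrow> x = y"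
  by (rule dvd_small_eq) (auto simp: A_range_iff)

lemma B_range_unique: "x \<in> B_range q \<Longrightarrow> y \<in> B_range q \<Longrightarrow> hB dvd x - y \<Longrightarrow> x = y"
  by (rule dvd_small_eq) (auto simp: B_range_iff)

lemma full_range_unique: "x \<in> full_range m \<Longrightarrow> y \<in> full_range m \<Longrightarrow> int m dvd x - y \<Longrightarrow> x = y"
  by (rule dvd_small_eq) (auto simp: full_range_iff)

lemma centered_remainder:
  fixes a h :: int
  assumes "h > 0"
  shows "\<exists>x k. a = x + h * k \<and> - h < 2 * x \<and> 2 * x \<le> h"
proof (cases "2 * (a mod h) \<le> h")
  case True
  then show ?thesis using assms
    by (intro exI[of _ "a mod h"] exI[of _ "a div h"]) (auto intro: order.strict_trans2[of _ 0])
next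
  case False
  have "a mod h < h" using assms by simp
  moreover have "a = (a mod h - h) + h * (a div h + 1)" by (simp add: algebra_simps)
  ultimately show ?thesis using False by (intro exI[of _ "a mod h - h"] exI[of _ "a div h + 1"]) auto
qed

lemma A_range_exists: "\<exists>x\<in>A_range p. \<exists>k. a = x + hA * k"
  using centered_remainder[OF half_pos(1), of a] unfolding Bex_def A_range_iff by blast

lemma B_range_exists: "\<exists>x\<in>B_range q. \<exists>k. b = x + hB * k"
proof -
  obtain x k where x: "b = x + hB * k" "- hB < 2 * x" "2 * x \<le> hB"
    using centered_remainder[OF half_pos(2), of b] by blast
  then have "2 * x \<noteq> hB" using odd_hB by (metis dvd_triv_left)
  then show ?thesis using x by (intro bexI[of _ x]) (auto simp: B_range_iff)
qed

lemma A_full_range: "\<exists>x\<in>full_range p. A a = A x"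
proof -
  obtain x k where x: "a = x + int p * k" "- int p < 2 * x" "2 * x \<le> int p"
    using centered_remainder[of "int p" a] p3 by auto
  have "A a = A x ** A (int p * k)" by (simp add: A_add x)
  then show ?thesis using x A_period[of "int p * k"] by (auto simp: full_range_iff)
qed

lemma B_full_range: "\<exists>x\<in>full_range q. B b = B x"
proof -
  obtain x k where x: "b = x + int q * k" "- int q < 2 * x" "2 * x \<le> int q"
    using centered_remainder[of "int q" b] q3 by auto
  have "B b = B x ** B (int q * k)" by (simp add: B_add x)
  then show ?thesis using x B_period[of "int q * k"] by (auto simp: full_range_iff)
qed

section \<open>Canonical forms as reduced words with exponents in prescribed ranges\<close>

definition L_ranges :: "(int \<times> int) list \<Rightarrow> bool" where
  "L_ranges ws \<longleftrightarrow> fst (hd ws) \<in> full_range p \<and> snd (hd ws) \<in> full_range q \<and>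
     (\<forall>x\<in>set (tl ws). fst x \<in> A_range p \<and> snd x \<in> B_range q)"

definition R_ranges :: "(int \<times> int) list \<Rightarrow> bool" where
  "R_ranges ws \<longleftrightarrow> fst (last ws) \<in> full_range p \<and> snd (last ws) \<in> full_range q \<and>
     (\<forall>x\<in>set (butlast ws). fst x \<in> A_range p \<and> snd x \<in> B_range q)"

definition C_ranges :: "(int \<times> int) list \<Rightarrow> bool" where
  "C_ranges ws \<longleftrightarrow> fst (hd ws) \<in> full_range p \<and> snd (last ws) \<in> full_range q \<and>
     (\<forall>x\<in>set (tl ws). fst x \<in> A_range p) \<and> (\<forall>x\<in>set (butlast ws). snd x \<in> B_range q)"

lemma ball_tl: "(\<forall>i<length ws. 0 < i \<longrightarrow> P (ws ! i)) \<longleftrightarrow> (\<forall>x\<in>set (tl ws). P x)"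
  by (cases ws) (auto simp: all_set_conv_all_nth less_Suc_eq_0_disj)

lemma ball_butlast: "(\<forall>i<length ws - 1. P (ws ! i)) \<longleftrightarrow> (\<forall>x\<in>set (butlast ws). P x)"
  by (auto simp: all_set_conv_all_nth nth_butlast)

lemma is_product_iff:
  "is_product ws \<longleftrightarrow> ws \<noteq> [] \<and> (\<forall>x\<in>set (tl ws). fst x \<noteq> 0) \<and> (\<forall>x\<in>set (butlast ws). snd x \<noteq> 0)"
  unfolding is_product_def ball_tl[of ws "\<lambda>x. fst x \<noteq> 0"] ball_butlast[of ws "\<lambda>x. snd x \<noteq> 0"] ..

lemma L_canonical_ranges:
  "L_canonical p q ws \<longleftrightarrow> is_product ws \<and> L_ranges ws \<and>
    (real_of_int (snd (hd ws)) = real q / 2 \<longrightarrow> length ws = 1)"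
  unfolding L_canonical_def L_ranges_def ball_tl[of ws "\<lambda>x. fst x \<in> A_range p"]
    ball_tl[of ws "\<lambda>x. snd x \<in> B_range q"]
  by (auto simp: is_product_def hd_conv_nth)

lemma R_canonical_ranges:
  "R_canonical p q ws \<longleftrightarrow> is_product ws \<and> R_ranges ws \<and>
    (real_of_int (fst (last ws)) = real p / 2 \<longrightarrow> length ws = 1)"
  unfolding R_canonical_def R_ranges_def ball_butlast[of ws "\<lambda>x. fst x \<in> A_range p"]
    ball_butlast[of ws "\<lambda>x. snd x \<in> B_range q"]
  by (auto simp: is_product_def last_conv_nth)

lemma C_canonical_ranges: "C_canonical p q ws \<longleftrightarrow> is_product ws \<and> C_ranges ws"
  unfolding C_canonical_def C_ranges_def ball_tl[of ws "\<lambda>x. fst x \<in> A_range p"]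
    ball_butlast[of ws "\<lambda>x. snd x \<in> B_range q"]
  by (auto simp: is_product_def hd_conv_nth last_conv_nth)

lemma A_range_dvd: "a \<in> A_range p \<Longrightarrow> hA dvd a \<longleftrightarrow> a = 0"
  using A_range_unique[of a 0] half_pos by (auto simp: A_range_iff)

lemma B_range_dvd: "b \<in> B_range q \<Longrightarrow> hB dvd b \<longleftrightarrow> b = 0"
  using B_range_unique[of b 0] half_pos by (auto simp: B_range_iff)

text \<open>The range admits only the quotients 0 and 1 by \<open>hA\<close>; the quotient 1 is the
  half turn that the R-form forbids in longer words.\<close>

lemma full_range_p_dvd: "a \<in> full_range p \<Longrightarrow> hA dvd a \<longleftrightarrow> a = 0 \<or> real_of_int a = real p / 2"
proof -
  assume a: "a \<in> full_range p"
  have "real_of_int a = real p / 2 \<longleftrightarrow> 2 * a = int p" by linarith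
  also have "\<dots> \<longleftrightarrow> a = hA" by (auto simp: p_eq)
  finally have eq: "real_of_int a = real p / 2 \<longleftrightarrow> a = hA" .
  have "a = 0 \<or> a = hA" if d: "hA dvd a"
  proof -
    obtain k where k: "a = hA * k" using d by blast
    have "- (2 * hA) < 2 * (hA * k)" "2 * (hA * k) \<le> 2 * hA"
      using a by (simp_all only: full_range_iff p_eq k)
    then have "hA * (- 1) < hA * k" "hA * k \<le> hA * 1" by linarith+
    then have "- 1 < k" "k \<le> 1" using half_pos by (simp_all only: mult_less_cancel_left_pos mult_le_cancel_left_pos)
    then have "k = 0 \<or> k = 1" by linarith
    then show ?thesis using k by auto
  qed
  then show ?thesis unfolding eq by auto
qed

text \<open>For odd \<open>q\<close> the exponent lies in \<open>B_range\<close> and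
  \<open>q / 2\<close> is not an integer, so only 0 remains.\<close>

lemma full_range_q_dvd: "b \<in> full_range q \<Longrightarrow> hB dvd b \<longleftrightarrow> b = 0 \<or> real_of_int b = real q / 2"
proof (cases "even q")
  case True
  assume b: "b \<in> full_range q"
  have "real_of_int b = real q / 2 \<longleftrightarrow> 2 * b = int q" by linarith
  also have "\<dots> \<longleftrightarrow> b = hB" by (auto simp: q_eq[OF True])
  finally have eq: "real_of_int b = real q / 2 \<longleftrightarrow> b = hB" .
  have "b = 0 \<or> b = hB" if d: "hB dvd b"
  proof -
    obtain k where k: "b = hB * k" using d by blast
    have "- (2 * hB) < 2 * (hB * k)" "2 * (hB * k) \<le> 2 * hB"
      using b by (simp_all only: full_range_iff q_eq[OF True] k)
    then have "hB * (- 1) < hB * k" "hB * k \<le> hB * 1" by linarith+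
    then have "- 1 < k" "k \<le> 1" using half_pos by (simp_all only: mult_less_cancel_left_pos mult_le_cancel_left_pos)
    then have "k = 0 \<or> k = 1" by linarith
    then show ?thesis using k by auto
  qed
  then show ?thesis unfolding eq by auto
next
  case False
  assume "b \<in> full_range q"
  then have "- int q < 2 * b" "2 * b \<le> int q" by (simp_all only: full_range_iff)
  moreover have "2 * b \<noteq> int q" using False by presburger
  ultimately have "b \<in> B_range q" using False by (simp add: B_range_iff hB_def)
  moreover have "real_of_int b \<noteq> real q / 2"
  proof
    assume "real_of_int b = real q / 2"
    then have "2 * b = int q" by linarith
    then show False using False by presburger
  qed
  ultimately show ?thesis by (simp add: B_range_dvd)
qed

lemma ball_A_range_dvd:
  "\<forall>x\<in>S. fst x \<in> A_range p \<Longrightarrow> (\<forall>x\<in>S. \<not> hA dvd fst x) \<longleftrightarrow> (\<forall>x\<in>S. fst x \<noteq> 0)"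
  by (intro ball_cong) (simp_all add: A_range_dvd)

lemma ball_B_range_dvd:
  "\<forall>x\<in>S. snd x \<in> B_range q \<Longrightarrow> (\<forall>x\<in>S. \<not> hB dvd snd x) \<longleftrightarrow> (\<forall>x\<in>S. snd x \<noteq> 0)"
  by (intro ball_cong) (simp_all add: B_range_dvd)

text \<open>Inside the ranges, a nonzero inner exponent is the same as one that is no multiple of a
  half turn. For the first exponent of \<open>B\<close>, which has the full range, the ban on
  \<open>q / 2\<close> in longer words supplies the missing case.\<close>

lemma L_canonical_iff: "L_canonical p q ws \<longleftrightarrow> reduced ws \<and> L_ranges ws"
proof (cases "L_ranges ws")
  case True
  show ?thesis
  proof (cases "length ws \<le> 1")
    case short: True
    then show ?thesis using True
      by (cases ws) (auto simp: L_canonical_ranges is_product_iff reduced_def)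
  next
    case False
    then obtain x y t where ws: "ws = x # y # t" by (cases ws; cases "tl ws") auto
    have A: "\<forall>z\<in>set (y # t). fst z \<in> A_range p"
      and B: "\<forall>z\<in>set (butlast (y # t)). snd z \<in> B_range q"
      and x: "snd x \<in> full_range q"
      using True by (auto simp: L_ranges_def ws dest: in_set_butlastD)
    show ?thesis
      using True ball_A_range_dvd[OF A] ball_B_range_dvd[OF B] full_range_q_dvd[OF x]
      by (auto simp: L_canonical_ranges is_product_iff reduced_def ws)
  qed
qed (simp add: L_canonical_ranges)

lemma R_canonical_iff: "R_canonical p q ws \<longleftrightarrow> reduced ws \<and> R_ranges ws"
proof (cases "R_ranges ws")
  case True
  show ?thesis
  proof (cases "length ws \<le> 1")
    case short: True
    then show ?thesis using True
      by (cases ws) (auto simp: R_canonical_ranges is_product_iff reduced_def)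
  next
    case False
    then obtain x t y where ws: "ws = (x # t) @ [y]"
      by (cases ws rule: rev_cases; cases "butlast ws") auto
    have A: "\<forall>z\<in>set t. fst z \<in> A_range p"
      and B: "\<forall>z\<in>set (x # t). snd z \<in> B_range q"
      and y: "fst y \<in> full_range p"
      using True by (auto simp: R_ranges_def ws butlast_append)
    have sets: "set (tl ws) = insert y (set t)" "set (butlast ws) = set (x # t)" "last ws = y"
      by (auto simp: ws butlast_append)
    show ?thesis
      using True ball_A_range_dvd[OF A] ball_B_range_dvd[OF B] full_range_p_dvd[OF y]
      unfolding R_canonical_ranges is_product_iff reduced_def sets by (auto simp: ws)
  qed
qed (simp add: R_canonical_ranges)

text \<open>The full-range exponents are the outermost ones, which \<open>reduced\<close> leaves
  free, so no half turn has to be excluded.\<close>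

lemma C_canonical_iff: "C_canonical p q ws \<longleftrightarrow> reduced ws \<and> C_ranges ws"
proof (cases "C_ranges ws")
  case True
  then show ?thesis
    using ball_A_range_dvd[of "set (tl ws)"] ball_B_range_dvd[of "set (butlast ws)"]
    by (simp add: C_canonical_ranges C_ranges_def is_product_iff reduced_def)
qed (simp add: C_canonical_ranges)

section \<open>Comparison of canonical words pair by pair\<close>

lemma half_multiple_A: "int p dvd hA * m \<longleftrightarrow> even m"
  using half_pos dvd_times_left_cancel_iff[of hA 2 m] unfolding p_eq by (metis less_irrefl mult.commute)

lemma half_multiple_B: "int q dvd hB * k \<Longrightarrow> even q \<Longrightarrow> even k"
  using half_pos dvd_times_left_cancel_iff[of hB 2 k] q_eq by (metis less_irrefl mult.commute)

lemma klein_trivial: "even m \<Longrightarrow> int q dvd hB * k \<Longrightarrow> klein m k = mat 1"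
  by (simp add: klein_def A_period B_period half_multiple_A)

lemma A_step_cong: "int p dvd x - (y + hA * m) \<Longrightarrow> hA dvd x - y"
proof -
  assume "int p dvd x - (y + hA * m)"
  then have "hA dvd (x - (y + hA * m)) + hA * m" using hA_dvd_p dvd_trans by (intro dvd_add) auto
  then show ?thesis by simp
qed

lemma B_step_cong: "int q dvd x - (y + hB * k) \<Longrightarrow> hB dvd x - y"
proof -
  assume "int q dvd x - (y + hB * k)"
  then have "hB dvd (x - (y + hB * k)) + hB * k" using hB_dvd_q dvd_trans by (intro dvd_add) auto
  then show ?thesis by simp
qed

lemma val_single_eq:
  assumes "val [(a, b)] = val [(a', b')]"
  shows "int p dvd a' - a" "int q dvd b' - b"
  using A_B_unique[of a b a' b'] assms by simp_all

text \<open>Comparison runs from the right. The last exponents of \<open>B\<close> agree modulo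
  \<open>hB\<close>, hence agree, which makes \<open>B (hB * k)\<close> trivial. So
  \<open>a'\<close> is not twisted, the exponents of \<open>A\<close> agree, \<open>m\<close> is
  even, and no Klein factor remains.\<close>

lemma L_unique:
  assumes "reduced ws" "reduced ws'" "L_ranges ws" "L_ranges ws'" "val ws = val ws'"
  shows "ws = ws'"
  using assms
proof (induction ws arbitrary: ws' rule: rev_induct)
  case Nil
  then show ?case by (simp add: reduced_def)
next
  case (snoc x us)
  obtain a b where x: "x = (a, b)" by (cases x)
  obtain vs a' b' where ws': "ws' = vs @ [(a', b')]"
    using snoc.prems(2) by (metis rev_exhaust reduced_def surj_pair)
  have r: "reduced (us @ [(a, b)])" "reduced (vs @ [(a', b')])" "val (us @ [(a, b)]) = val (vs @ [(a', b')])"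
    using snoc.prems by (simp_all add: x ws')
  obtain m k where len: "length us = length vs" and p: "int p dvd hA * m + twist_B k a' - a"
    and q: "int q dvd hB * k + b' - b" and eq: "val us ** klein m k = val vs"
    using reduced_snoc_eq[OF r] by blast
  show ?case
  proof (cases "us = []")
    case True
    then have "vs = []" using len by simp
    then show ?thesis using True snoc.prems(3-5) val_single_eq[of a b a' b']
        full_range_unique[of a' p a] full_range_unique[of b' q b]
      by (simp add: x ws' L_ranges_def)
  next
    case False
    then have vs: "vs \<noteq> []" using len by auto
    have ranges: "a \<in> A_range p" "a' \<in> A_range p" "b \<in> B_range q" "b' \<in> B_range q"
      using snoc.prems(3,4) False vs by (auto simp: L_ranges_def x ws')
    have "hB dvd b' - b" using B_step_cong[of "b'" b "- k"] q by (simp add: algebra_simps)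
    then have b: "b' = b" using ranges B_range_unique by blast
    then have qk: "int q dvd hB * k" using q by simp
    then have "twist_B k a' = a'" using half_multiple_B by (auto simp: twist_B_def)
    then have "int p dvd a' - (a + hA * (- m))" using p by (simp add: algebra_simps)
    then have "hA dvd a' - a" by (rule A_step_cong)
    then have a: "a' = a" using ranges A_range_unique by blast
    then have "even m" using p \<open>twist_B k a' = a'\<close> by (simp add: half_multiple_A)
    then have "val us = val vs" using eq qk by (simp add: klein_trivial)
    moreover have "L_ranges us" "L_ranges vs"
      using snoc.prems(3,4) False vs by (auto simp: L_ranges_def ws')
    moreover have "reduced us" "reduced vs"
      using r(1,2) False vs by (auto simp: reduced_snoc proper_reduced)
    ultimately have "us = vs" using snoc.IH by blast
    then show ?thesis using a b by (simp add: x ws')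
  qed
qed

text \<open>The mirror image: comparison runs from the left, with \<open>A\<close> first. Once
  \<open>m\<close> is even, \<open>b\<close> is not twisted.\<close>

lemma R_unique:
  assumes "reduced ws" "reduced ws'" "R_ranges ws" "R_ranges ws'" "val ws = val ws'"
  shows "ws = ws'"
  using assms
proof (induction ws arbitrary: ws')
  case Nil
  then show ?case by (simp add: reduced_def)
next
  case (Cons x t)
  obtain a b where x: "x = (a, b)" by (cases x)
  obtain a' b' t' where ws': "ws' = (a', b') # t'"
    using Cons.prems(2) by (metis reduced_def list.exhaust surj_pair)
  have r: "reduced ((a, b) # t)" "reduced ((a', b') # t')" "val ((a, b) # t) = val ((a', b') # t')"
    using Cons.prems by (simp_all only: x ws')
  obtain m k where len: "length t = length t'" and p: "int p dvd a' - (a + hA * m)"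
    and q: "int q dvd b' - (twist_A m b + hB * k)" and eq: "val t = klein m k ** val t'"
    using reduced_Cons_eq[OF r] by blast
  show ?case
  proof (cases t)
    case Nil
    then have "t' = []" using len by simp
    then show ?thesis using Nil Cons.prems(3-5) val_single_eq[of a b a' b']
        full_range_unique[of a' p a] full_range_unique[of b' q b]
      by (simp add: x ws' R_ranges_def)
  next
    case (Cons y s)
    then obtain y' s' where t': "t' = y' # s'" using len by (cases t') auto
    have ranges: "a \<in> A_range p" "a' \<in> A_range p" "b \<in> B_range q" "b' \<in> B_range q"
      using Cons.prems(3,4) Cons t' by (auto simp: R_ranges_def x ws')
    have a: "a' = a" using A_step_cong[OF p] ranges A_range_unique by blast
    then have m: "even m" using p by (simp add: half_multiple_A)
    then have q': "int q dvd b' - (b + hB * k)" using q by (simp add: twist_A_def)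
    then have b: "b' = b" using B_step_cong ranges B_range_unique by blast
    then have "val t = val t'" using eq q' m by (simp add: klein_trivial)
    moreover have "R_ranges t" "R_ranges t'"
      using Cons.prems(3,4) Cons t' by (auto simp: R_ranges_def ws')
    moreover have "reduced t" "reduced t'"
      using r(1,2) Cons t' by (auto simp: reduced_Cons)
    ultimately have "t = t'" using Cons.IH by blast
    then show ?thesis using a b by (simp add: x ws')
  qed
qed

text \<open>In the C-form only a half turn about the x-axis can travel from left to right; the last
  pair forces it to be trivial.\<close>

lemma C_unique_aux:
  assumes "reduced ws" "reduced ws'" "val ws = A (hA * n) ** val ws'"
    and "\<forall>x\<in>set ws. fst x \<in> A_range p" "\<forall>x\<in>set ws'. fst x \<in> A_range p"
    and "\<forall>x\<in>set (butlast ws). snd x \<in> B_range q" "\<forall>x\<in>set (butlast ws'). snd x \<in> B_range q"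
    and "snd (last ws) \<in> full_range q" "snd (last ws') \<in> full_range q"
  shows "ws = ws' \<and> even n"
  using assms
proof (induction ws arbitrary: ws' n)
  case Nil
  then show ?case by (simp add: reduced_def)
next
  case (Cons x t)
  obtain a b where x: "x = (a, b)" by (cases x)
  obtain a' b' t' where ws': "ws' = (a', b') # t'"
    using Cons.prems(2) by (metis reduced_def list.exhaust surj_pair)
  \<comment> \<open>The incoming half turn is absorbed into the first exponent of
    \<open>ws'\<close>, on which \<open>reduced\<close> places no condition.\<close>
  have r: "reduced ((a, b) # t)" "reduced ((a' + hA * n, b') # t')"
    "val ((a, b) # t) = val ((a' + hA * n, b') # t')"
    using Cons.prems reduced_fst[of a' b' t' "a' + hA * n"] by (simp_all add: x ws' word_simps add.commute)
  obtain m k where len: "length t = length t'" and p: "int p dvd a' + hA * n - (a + hA * m)"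
    and q: "int q dvd b' - (twist_A m b + hB * k)" and eq: "val t = klein m k ** val t'"
    using reduced_Cons_eq[OF r] by blast
  have "int p dvd a' - (a + hA * (m - n))" using p by (simp add: algebra_simps)
  then have "hA dvd a' - a" by (rule A_step_cong)
  then have a: "a' = a" using A_range_unique Cons.prems(4,5) by (auto simp: x ws')
  show ?case
  proof (cases t)
    case Nil
    then have t': "t' = []" using len by simp
    then have "int p dvd a' + hA * n - a" "int q dvd b' - b"
      using val_single_eq[of a b "a' + hA * n" b'] r(3) Nil by simp_all
    then show ?thesis using Nil t' a Cons.prems(8,9) full_range_unique[of b' q b]
      by (simp add: x ws' half_multiple_A)
  next
    case (Cons y s)
    then obtain y' s' where t': "t' = y' # s'" using len by (cases t') auto
    have ranges: "b \<in> B_range q" "b' \<in> B_range q"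
      using Cons.prems(6,7) Cons t' by (auto simp: x ws')
    \<comment> \<open>By symmetry of \<open>B_range\<close> the twisted exponent is in range as
      well. Equality makes \<open>B (hB * k)\<close> trivial, so only \<open>A (hA * m)\<close>
      travels on.\<close>
    have b: "b' = twist_A m b"
      using B_step_cong[OF q] ranges by (intro B_range_unique) (auto simp: B_range_iff)
    then have "val t = A (hA * m) ** val t'" using eq q by (simp add: klein_def B_period)
    moreover have "reduced t" "reduced t'"
      using r(1,2) Cons t' by (auto simp: reduced_Cons)
    ultimately have "t = t' \<and> even m"
      using Cons.prems(4-9) Cons t' by (intro Cons.IH) (auto simp: ws')
    moreover have "int p dvd hA * (n - m)" using p a by (simp add: algebra_simps)
    ultimately show ?thesis using a b by (auto simp: x ws' half_multiple_A twist_A_def)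
  qed
qed

text \<open>The first exponent of \<open>A\<close> has the full range, so it is settled only after
  \<open>C_unique_aux\<close> has shown that the half turn passed to the tail is trivial.\<close>

lemma C_unique:
  assumes "reduced ws" "reduced ws'" "C_ranges ws" "C_ranges ws'" "val ws = val ws'"
  shows "ws = ws'"
proof -
  obtain a b t where ws: "ws = (a, b) # t"
    using assms(1) by (metis reduced_def list.exhaust surj_pair)
  obtain a' b' t' where ws': "ws' = (a', b') # t'"
    using assms(2) by (metis reduced_def list.exhaust surj_pair)
  have r: "reduced ((a, b) # t)" "reduced ((a', b') # t')" "val ((a, b) # t) = val ((a', b') # t')"
    using assms by (simp_all only: ws ws')
  obtain m k where len: "length t = length t'" and p: "int p dvd a' - (a + hA * m)"
    and q: "int q dvd b' - (twist_A m b + hB * k)" and eq: "val t = klein m k ** val t'"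
    using reduced_Cons_eq[OF r] by blast
  show ?thesis
  proof (cases t)
    case Nil
    then have "t' = []" using len by simp
    then show ?thesis using Nil assms(3-5) val_single_eq[of a b a' b']
        full_range_unique[of a' p a] full_range_unique[of b' q b]
      by (simp add: ws ws' C_ranges_def)
  next
    case (Cons y s)
    then obtain y' s' where t': "t' = y' # s'" using len by (cases t') auto
    have ranges: "b \<in> B_range q" "b' \<in> B_range q"
      using assms(3,4) Cons t' by (auto simp: C_ranges_def ws ws')
    have b: "b' = twist_A m b"
      using B_step_cong[OF q] ranges by (intro B_range_unique) (auto simp: B_range_iff)
    then have "val t = A (hA * m) ** val t'" using eq q by (simp add: klein_def B_period)
    moreover have "reduced t" "reduced t'"
      using r(1,2) Cons t' by (auto simp: reduced_Cons)
    ultimately have t: "t = t' \<and> even m"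
      using assms(3,4) Cons t' by (intro C_unique_aux) (auto simp: ws ws' C_ranges_def)
    then have "int p dvd hA * m" by (simp add: half_multiple_A)
    from dvd_add[OF p this] have "int p dvd a' - a" by simp
    then have "a' = a" using assms(3,4) by (intro full_range_unique) (auto simp: ws ws' C_ranges_def)
    then show ?thesis using t b by (simp add: ws ws' twist_A_def)
  qed
qed

section \<open>Existence of canonical forms\<close>

lemma pair_half_pair:
  "A a ** B (hB * k) ** (A a' ** B b') = A (a + twist_B k a') ** B (hB * k + b')"
  "A a ** B b ** (A (hA * m) ** B b') = A (a + hA * m) ** B (twist_A m b + b')"
  by (simp_all add: word_simps B_half_A_left B_A_half_left)

lemma merge_pairs:
  assumes "A a ** B b ** (A a' ** B b') = A c ** B d"
  shows "val (us @ (a, b) # (a', b') # vs) = val (us @ (c, d) # vs)"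
proof -
  have "val ((a, b) # (a', b') # vs) = A a ** B b ** (A a' ** B b') ** val vs"
    by (simp add: matrix_mul_assoc)
  then show ?thesis by (simp add: val_append assms)
qed

text \<open>A half turn at an inner position can be moved past its neighbour, which merges two pairs
  and shortens the word.\<close>

lemma minimal_reduced:
  assumes "ws \<noteq> []" and min: "\<And>us. us \<noteq> [] \<Longrightarrow> val us = val ws \<Longrightarrow> length ws \<le> length us"
  shows "reduced ws"
proof -
  have no_merge: False
    if ws: "ws = us @ (a, b) # (a', b') # vs" and "A a ** B b ** (A a' ** B b') = A c ** B d"
    for us a b a' b' vs c d
    using min[of "us @ (c, d) # vs"] merge_pairs[OF that(2), of us vs] ws by simp
  have "\<not> hA dvd fst x" if x: "x \<in> set (tl ws)" for x
  proof
    assume "hA dvd fst x"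
    then obtain m where m: "fst x = hA * m" by blast
    obtain ys zs where "tl ws = ys @ x # zs" using x by (meson split_list)
    then have "ws = (hd ws # ys) @ x # zs" using assms(1) by (cases ws) auto
    moreover obtain us y where "hd ws # ys = us @ [y]" by (metis list.distinct(1) rev_exhaust)
    ultimately have "ws = us @ (fst y, snd y) # (hA * m, snd x) # zs" using m by (simp flip: m)
    then show False using no_merge pair_half_pair(2) by blast
  qed
  moreover have "\<not> hB dvd snd x" if x: "x \<in> set (butlast ws)" for x
  proof
    assume "hB dvd snd x"
    then obtain k where k: "snd x = hB * k" by blast
    obtain ys zs where "butlast ws = ys @ x # zs" using x by (meson split_list)
    then have "ws = ys @ x # (zs @ [last ws])"
      using assms(1) by (metis append_Cons append_assoc append_butlast_last_id)
    moreover obtain y vs where "zs @ [last ws] = y # vs" by (cases "zs @ [last ws]") auto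
    ultimately have "ws = ys @ (fst x, hB * k) # (fst y, snd y) # vs" using k by (simp flip: k)
    then show False using no_merge pair_half_pair(1) by blast
  qed
  ultimately show ?thesis using assms(1) unfolding reduced_def by blast
qed

text \<open>Each exponent of \<open>B\<close> keeps its representative and hands the surplus
  multiple of \<open>hB\<close> to the next pair, changing at most the sign of the exponent of
  \<open>A\<close> in between. The tail is altered, hence the induction on length.\<close>

lemma push_B_right:
  assumes "ws \<noteq> []"
  shows "\<exists>ws'. length ws' = length ws \<and> val ws' = val ws \<and> (\<forall>x\<in>set (butlast ws'). snd x \<in> B_range q)"
  using assms
proof (induction "length ws" arbitrary: ws)
  case (Suc n)
  obtain a b t where ws: "ws = (a, b) # t" using Suc.prems by (metis list.exhaust surj_pair)
  show ?case
  proof (cases t)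
    case Nil
    then show ?thesis using ws by (intro exI[of _ ws]) simp
  next
    case (Cons y s)
    obtain a' b' where y: "y = (a', b')" by (cases y)
    obtain x k where x: "x \<in> B_range q" "b = x + hB * k" using B_range_exists by blast
    let ?t = "(twist_B k a', hB * k + b') # s"
    have len: "n = length ?t" "?t \<noteq> []" using Suc.hyps(2) by (auto simp: ws Cons)
    obtain t' where t': "length t' = length ?t" "val t' = val ?t" "\<forall>x\<in>set (butlast t'). snd x \<in> B_range q"
      using Suc.hyps(1)[OF len] by blast
    have "B b ** (A a' ** X) = B x ** (A (twist_B k a') ** (B (hB * k) ** X))" for X :: "real^3^3"
      by (simp only: x B_half_A_left[symmetric]) (simp add: word_simps)
    then have "val ws = val ((a, x) # ?t)"
      by (simp add: ws Cons y word_simps)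
    then show ?thesis using t' x by (intro exI[of _ "(a, x) # t'"]) (auto simp: ws Cons)
  qed
qed simp

text \<open>Half turns about the x-axis flip signs of exponents of \<open>B\<close>. The absolute
  values are recorded so that membership in \<open>B_range\<close> survives.\<close>

lemma push_A_right:
  assumes "ws \<noteq> []"
  shows "\<exists>ws'. length ws' = length ws \<and> val ws' = val ws \<and> (\<forall>x\<in>set (butlast ws'). fst x \<in> A_range p) \<and>
    map (\<lambda>x. \<bar>snd x\<bar>) ws' = map (\<lambda>x. \<bar>snd x\<bar>) ws"
  using assms
proof (induction "length ws" arbitrary: ws)
  case (Suc n)
  obtain a b t where ws: "ws = (a, b) # t" using Suc.prems by (metis list.exhaust surj_pair)
  show ?case
  proof (cases t)
    case Nil
    then show ?thesis using ws by (intro exI[of _ ws]) simp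
  next
    case (Cons y s)
    obtain a' b' where y: "y = (a', b')" by (cases y)
    obtain x m where x: "x \<in> A_range p" "a = x + hA * m" using A_range_exists by blast
    let ?t = "(hA * m + a', b') # s"
    have len: "n = length ?t" "?t \<noteq> []" using Suc.hyps(2) by (auto simp: ws Cons)
    obtain t' where t': "length t' = length ?t" "val t' = val ?t" "\<forall>x\<in>set (butlast t'). fst x \<in> A_range p"
      "map (\<lambda>x. \<bar>snd x\<bar>) t' = map (\<lambda>x. \<bar>snd x\<bar>) ?t"
      using Suc.hyps(1)[OF len] by blast
    have "A a ** (B b ** X) = A x ** (B (twist_A m b) ** (A (hA * m) ** X))" for X :: "real^3^3"
      by (simp add: x word_simps B_A_half_left)
    then have "val ws = val ((x, twist_A m b) # ?t)"
      by (simp add: ws Cons y word_simps)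
    then show ?thesis using t' x
      by (intro exI[of _ "(x, twist_A m b) # t'"]) (auto simp: ws Cons y)
  qed
qed simp

lemma push_B_left:
  assumes "ws \<noteq> []"
  shows "\<exists>ws'. length ws' = length ws \<and> val ws' = val ws \<and> (\<forall>x\<in>set (tl ws'). snd x \<in> B_range q)"
  using assms
proof (induction "length ws" arbitrary: ws)
  case (Suc n)
  obtain a b t where ws: "ws = t @ [(a, b)]" using Suc.prems by (metis rev_exhaust surj_pair)
  show ?case
  proof (cases t rule: rev_cases)
    case Nil
    then show ?thesis using ws by (intro exI[of _ ws]) simp
  next
    case (snoc s y)
    obtain a' b' where y: "y = (a', b')" by (cases y)
    obtain x k where x: "x \<in> B_range q" "b = x + hB * k" using B_range_exists by blast
    let ?t = "s @ [(a', b' + hB * k)]"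
    have len: "n = length ?t" "?t \<noteq> []" using Suc.hyps(2) by (auto simp: ws snoc)
    obtain t' where t': "length t' = length ?t" "val t' = val ?t" "\<forall>x\<in>set (tl t'). snd x \<in> B_range q"
      using Suc.hyps(1)[OF len] by blast
    have "A a ** B b = B (hB * k) ** (A (twist_B k a) ** B x)"
      by (simp add: x word_simps B_half_A_left add.commute)
    then have "val ws = val (?t @ [(twist_B k a, x)])"
      by (simp add: ws snoc y val_append word_simps)
    moreover have "t' \<noteq> []" using t' by auto
    ultimately show ?thesis using t' x
      by (intro exI[of _ "t' @ [(twist_B k a, x)]"]) (auto simp: ws snoc val_append matrix_mul_assoc)
  qed
qed simp

lemma push_A_left:
  assumes "ws \<noteq> []"
  shows "\<exists>ws'. length ws' = length ws \<and> val ws' = val ws \<and> (\<forall>x\<in>set (tl ws'). fst x \<in> A_range p) \<and>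
    map (\<lambda>x. \<bar>snd x\<bar>) ws' = map (\<lambda>x. \<bar>snd x\<bar>) ws"
  using assms
proof (induction "length ws" arbitrary: ws)
  case (Suc n)
  obtain a b t where ws: "ws = t @ [(a, b)]" using Suc.prems by (metis rev_exhaust surj_pair)
  show ?case
  proof (cases t rule: rev_cases)
    case Nil
    then show ?thesis using ws by (intro exI[of _ ws]) simp
  next
    case (snoc s y)
    obtain a' b' where y: "y = (a', b')" by (cases y)
    obtain x m where x: "x \<in> A_range p" "a = x + hA * m" using A_range_exists by blast
    let ?t = "s @ [(a' + hA * m, twist_A m b')]"
    have len: "n = length ?t" "?t \<noteq> []" using Suc.hyps(2) by (auto simp: ws snoc)
    obtain t' where t': "length t' = length ?t" "val t' = val ?t" "\<forall>x\<in>set (tl t'). fst x \<in> A_range p"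
      "map (\<lambda>x. \<bar>snd x\<bar>) t' = map (\<lambda>x. \<bar>snd x\<bar>) ?t"
      using Suc.hyps(1)[OF len] by blast
    have "A a' ** (B b' ** (A a ** B b)) = A (a' + hA * m) ** (B (twist_A m b') ** (A x ** B b))"
    proof -
      have "A a ** B b = A (hA * m) ** (A x ** B b)" by (simp add: x word_simps add.commute)
      then show ?thesis by (simp only: B_A_half_left) (simp add: word_simps)
    qed
    then have "val ws = val (?t @ [(x, b)])"
      by (simp add: ws snoc y val_append matrix_mul_assoc[symmetric])
    moreover have "t' \<noteq> []" using t' by auto
    ultimately show ?thesis using t' x
      by (intro exI[of _ "t' @ [(x, b)]"]) (auto simp: ws snoc y val_append matrix_mul_assoc)
  qed
qed simp

lemma abs_snd_B_range:
  assumes "map (\<lambda>x. \<bar>snd x\<bar>) ws' = map (\<lambda>x. \<bar>snd x\<bar>) ws" "\<forall>x\<in>set ws. snd x \<in> B_range q"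
  shows "\<forall>x\<in>set ws'. snd x \<in> B_range q"
proof
  fix x assume "x \<in> set ws'"
  then have "\<bar>snd x\<bar> \<in> set (map (\<lambda>x. \<bar>snd x\<bar>) ws')" by auto
  then obtain y where "y \<in> set ws" "\<bar>snd x\<bar> = \<bar>snd y\<bar>" using assms(1) by auto
  then show "snd x \<in> B_range q" using assms(2) by (auto simp: B_range_iff)
qed

lemma L_exists:
  assumes "ws \<noteq> []"
  shows "\<exists>ws'. length ws' = length ws \<and> val ws' = val ws \<and> L_ranges ws'"
proof -
  \<comment> \<open>\<open>B\<close> comes before \<open>A\<close>: pushing \<open>B\<close> may
    flip exponents of \<open>A\<close>, and \<open>A_range\<close> need not be symmetric, whereas
    \<open>B_range\<close> is.\<close>
  obtain us where us: "length us = length ws" "val us = val ws" "\<forall>x\<in>set (tl us). snd x \<in> B_range q"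
    using push_B_left[OF assms] by blast
  then have "us \<noteq> []" using assms by auto
  then obtain vs where vs: "length vs = length us" "val vs = val us" "\<forall>x\<in>set (tl vs). fst x \<in> A_range p"
    "map (\<lambda>x. \<bar>snd x\<bar>) vs = map (\<lambda>x. \<bar>snd x\<bar>) us"
    using push_A_left by blast
  have B: "\<forall>x\<in>set (tl vs). snd x \<in> B_range q"
    using abs_snd_B_range[of "tl vs" "tl us"] vs us by (simp add: map_tl)
  obtain a b t where ws': "vs = (a, b) # t" using vs \<open>us \<noteq> []\<close> by (cases vs) auto
  obtain a' b' where "a' \<in> full_range p" "A a = A a'" "b' \<in> full_range q" "B b = B b'"
    using A_full_range B_full_range by meson
  then show ?thesis using us vs B
    by (intro exI[of _ "(a', b') # t"]) (auto simp: L_ranges_def ws')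
qed

lemma R_exists:
  assumes "ws \<noteq> []"
  shows "\<exists>ws'. length ws' = length ws \<and> val ws' = val ws \<and> R_ranges ws'"
proof -
  obtain us where us: "length us = length ws" "val us = val ws" "\<forall>x\<in>set (butlast us). snd x \<in> B_range q"
    using push_B_right[OF assms] by blast
  then have "us \<noteq> []" using assms by auto
  then obtain vs where vs: "length vs = length us" "val vs = val us" "\<forall>x\<in>set (butlast vs). fst x \<in> A_range p"
    "map (\<lambda>x. \<bar>snd x\<bar>) vs = map (\<lambda>x. \<bar>snd x\<bar>) us"
    using push_A_right by blast
  have B: "\<forall>x\<in>set (butlast vs). snd x \<in> B_range q"
    using abs_snd_B_range[of "butlast vs" "butlast us"] vs us by (simp add: map_butlast)
  obtain a b t where ws': "vs = t @ [(a, b)]" using vs \<open>us \<noteq> []\<close> by (cases vs rule: rev_cases) auto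
  obtain a' b' where "a' \<in> full_range p" "A a = A a'" "b' \<in> full_range q" "B b = B b'"
    using A_full_range B_full_range by meson
  then show ?thesis using us vs B
    by (intro exI[of _ "t @ [(a', b')]"]) (auto simp: R_ranges_def ws' val_append)
qed

lemma C_exists:
  assumes "ws \<noteq> []"
  shows "\<exists>ws'. length ws' = length ws \<and> val ws' = val ws \<and> C_ranges ws'"
proof -
  obtain us where us: "length us = length ws" "val us = val ws" "\<forall>x\<in>set (butlast us). snd x \<in> B_range q"
    using push_B_right[OF assms] by blast
  then have "us \<noteq> []" using assms by auto
  then obtain vs where vs: "length vs = length us" "val vs = val us" "\<forall>x\<in>set (tl vs). fst x \<in> A_range p"
    "map (\<lambda>x. \<bar>snd x\<bar>) vs = map (\<lambda>x. \<bar>snd x\<bar>) us"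
    using push_A_left by blast
  have B: "\<forall>x\<in>set (butlast vs). snd x \<in> B_range q"
    using abs_snd_B_range[of "butlast vs" "butlast us"] vs us by (simp add: map_butlast)
  obtain a b t where ws1: "vs = (a, b) # t" using vs \<open>us \<noteq> []\<close> by (cases vs) auto
  obtain a' where a': "a' \<in> full_range p" "A a = A a'" using A_full_range by meson
  \<comment> \<open>The first and the last pair may coincide, so the word is split at its end only
    after the first exponent has been adjusted.\<close>
  obtain c d s where ws2: "(a', b) # t = s @ [(c, d)]" by (metis list.distinct(1) rev_exhaust surj_pair)
  obtain d' where d': "d' \<in> full_range q" "B d = B d'" using B_full_range by meson
  have "val (s @ [(c, d')]) = val ((a', b) # t)" using d' by (simp add: ws2 val_append)
  also have "\<dots> = val ws" using us vs a' by (simp add: ws1)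
  finally have val: "val (s @ [(c, d')]) = val ws" .
  have "length (s @ [(c, d')]) = length ws"
    using us(1) vs(1) arg_cong[OF ws2, of length] by (simp add: ws1)
  moreover have "\<forall>x\<in>set s. snd x \<in> B_range q"
  proof -
    have "s = butlast ((a', b) # t)" by (simp add: ws2)
    then show ?thesis using B by (auto simp: ws1 split: if_splits)
  qed
  moreover have "fst (hd (s @ [(c, d')])) = a' \<and> (\<forall>x\<in>set (tl (s @ [(c, d')])). fst x \<in> A_range p)"
    using ws2 vs(3) by (cases s) (auto simp: ws1)
  ultimately show ?thesis using val a' d'
    by (intro exI[of _ "s @ [(c, d')]"]) (simp add: C_ranges_def)
qed

text \<open>\<open>P\<close> is attained without changing the length, so a shortest word for
  \<open>g\<close> yields a shortest word with \<open>P\<close>, which is reduced by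
  \<open>minimal_reduced\<close>.\<close>

lemma reduced_word_exists_unique:
  assumes "\<exists>ws. ws \<noteq> [] \<and> val ws = g"
    and "\<And>ws. ws \<noteq> [] \<Longrightarrow> \<exists>ws'. length ws' = length ws \<and> val ws' = val ws \<and> P ws'"
    and "\<And>ws ws'. reduced ws \<Longrightarrow> reduced ws' \<Longrightarrow> P ws \<Longrightarrow> P ws' \<Longrightarrow> val ws = val ws' \<Longrightarrow> ws = ws'"
  shows "\<exists>!ws. (reduced ws \<and> P ws) \<and> val ws = g"
proof -
  obtain ws where ws: "ws \<noteq> []" "val ws = g"
    and min: "\<And>us. us \<noteq> [] \<Longrightarrow> val us = g \<Longrightarrow> length ws \<le> length us"
  proof -
    obtain ws0 where "ws0 \<noteq> [] \<and> val ws0 = g" using assms(1) by blast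
    from ex_has_least_nat[where P = "\<lambda>ws. ws \<noteq> [] \<and> val ws = g" and m = length, OF this]
    show thesis using that by blast
  qed
  obtain ws' where ws': "length ws' = length ws" "val ws' = val ws" "P ws'"
    using assms(2) ws(1) by blast
  have "ws' \<noteq> []" using ws(1) ws'(1) by auto
  then have "reduced ws'"
    using ws ws' min by (intro minimal_reduced) simp_all
  show ?thesis
  proof (intro ex1I[of _ ws'])
    show "(reduced ws' \<and> P ws') \<and> val ws' = g" using \<open>reduced ws'\<close> ws' ws by simp
    show "us = ws'" if "(reduced us \<and> P us) \<and> val us = g" for us
      using that \<open>reduced ws'\<close> ws' ws by (intro assms(3)) auto
  qed
qed

section \<open>Words as elements of the generated subgroup\<close>

lemma A_gen_eq: "A_gen p = A 1" and B_gen_eq: "B_gen q = B 1"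
  by (simp_all add: A_gen_def A_def B_gen_def B_def)

lemma SO3_power:
  fixes f :: "int \<Rightarrow> real^3^3" and k :: int
  assumes f: "\<And>i j. f i ** f j = f (i + j)" "f 0 = mat 1" "\<And>i. f i \<in> carrier SO3"
  shows "f 1 [^]\<^bsub>SO3\<^esub> k = f k"
proof -
  interpret group SO3 by (rule group_SO3)
  have nat: "f 1 [^]\<^bsub>SO3\<^esub> n = f (int n)" for n :: nat
    by (induction n) (simp_all add: f SO3_def add.commute)
  have inv: "inv\<^bsub>SO3\<^esub> f i = f (- i)" for i
    by (intro inv_equality f) (simp add: SO3_def f)
  show ?thesis
    by (cases k rule: int_cases2) (simp_all only: int_pow_neg int_pow_int nat inv f)
qed

lemma A_in_SO3: "A a \<in> carrier SO3" and B_in_SO3: "B b \<in> carrier SO3"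
  by (simp_all add: A_def B_def Rx_in_SO3 Rz_in_SO3)

lemma A_gen_power: "A_gen p [^]\<^bsub>SO3\<^esub> (a :: int) = A a"
  unfolding A_gen_eq by (intro SO3_power A_add A_0 A_in_SO3)

lemma B_gen_power: "B_gen q [^]\<^bsub>SO3\<^esub> (b :: int) = B b"
  unfolding B_gen_eq by (intro SO3_power B_add B_0 B_in_SO3)

lemma product_value_eq_val: "product_value p q ws = val ws"
  by (induction ws rule: val.induct) (simp_all add: A_gen_power B_gen_power, simp_all add: SO3_def)

lemma G_word:
  assumes "g \<in> G p q"
  shows "\<exists>ws. ws \<noteq> [] \<and> val ws = g"
  using assms unfolding G_def
proof induction
  case one
  \<comment> \<open>Words must be nonempty, so the identity is written with one pair of zero
    exponents.\<close>
  then show ?case by (intro exI[of _ "[(0, 0)]"]) (simp add: word_simps SO3_def)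
next
  case (incl h)
  have "val [(1, 0)] = A_gen p" "val [(0, 1)] = B_gen q"
    by (simp_all add: word_simps A_gen_eq B_gen_eq)
  then show ?case using incl by blast
next
  case (inv h)
  interpret group SO3 by (rule group_SO3)
  have "inv\<^bsub>SO3\<^esub> A 1 = A (- 1)" "inv\<^bsub>SO3\<^esub> B 1 = B (- 1)"
    by (intro inv_equality A_in_SO3 B_in_SO3; simp add: SO3_def word_simps)+
  then have "val [(- 1, 0)] = inv\<^bsub>SO3\<^esub> A_gen p" "val [(0, - 1)] = inv\<^bsub>SO3\<^esub> B_gen q"
    by (simp_all add: word_simps A_gen_eq B_gen_eq)
  then show ?case using inv by blast
next
  case (eng h1 h2)
  then obtain us vs where "us \<noteq> []" "val us = h1" "val vs = h2" by blast
  then show ?case by (intro exI[of _ "us @ vs"]) (simp add: val_append SO3_def)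
qed

end

theorem theorem3:
  fixes p q :: nat
  assumes "p \<ge> 3" and "q \<ge> 3" and "even p" and "\<not> 4 dvd q"
  shows "\<forall>g\<in>G p q.
           (\<exists>!ws. L_canonical p q ws \<and> product_value p q ws = g) \<and>
           (\<exists>!ws. R_canonical p q ws \<and> product_value p q ws = g) \<and>
           (\<exists>!ws. C_canonical p q ws \<and> product_value p q ws = g)"
proof -
  interpret even_rotation_pair p q using assms by unfold_locales
  show ?thesis
    unfolding L_canonical_iff R_canonical_iff C_canonical_iff product_value_eq_val
    by (intro ballI conjI reduced_word_exists_unique G_word)
       (blast intro: L_exists R_exists C_exists L_unique R_unique C_unique)+
qed

end
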